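(* $\pi(P \square P) \ge 6$ and $\pi(P \boxtimes P) \ge 9$.
   Context: $P$ denotes the infinite path: $V(P)=\mathbb{Z}$, with $i \sim j$ if and only if $|i-j|=1$. The Cartesian product $G \square H$ has vertex set $V(G)\times V(H)$, with $(u_1,v_1)\sim(u_2,v_2)$ iff either $u_1=u_2$ and $v_1v_2\in E(H)$, or $v_1=v_2$ and $u_1u_2\in E(G)$. The strong product $G\boxtimes H$ has vertex set $V(G)\times V(H)$, with $(u_1,v_1)\sim(u_2,v_2)$ iff either $u_1=u_2$ and $v_1v_2\in E(H)$, or $v_1=v_2$ and $u_1u_2\in E(G)$, or $u_1u_2\in E(G)$ and $v_1v_2\in E(H)$. A vertex coloring $f$ of a graph $G$ is non-repetitive if there is no path $\langle v_1,\dots,v_{2k}\rangle$ in $G$ ($k\ge1$) with $f(v_i)=f(v_{k+i})$ for all $1\le i\le k$. The non-repetitive chromatic number (Thue number) $\pi(G)$ is the minimum number of colors in a non-repetitive coloring of $G$. *)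

theory Defs
  imports Main "HOL-Library.Extended_Nat"
begin

text \<open>Graphs are given by a symmetric adjacency relation on the whole type.\<close>

definition path_graph :: "int \<Rightarrow> int \<Rightarrow> bool" where
  "path_graph i j \<longleftrightarrow> \<bar>i - j\<bar> = 1"

definition cart_prod :: "('a \<Rightarrow> 'a \<Rightarrow> bool) \<Rightarrow> ('b \<Rightarrow> 'b \<Rightarrow> bool)
    \<Rightarrow> ('a \<times> 'b) \<Rightarrow> ('a \<times> 'b) \<Rightarrow> bool" where
  "cart_prod G H x y \<longleftrightarrow>
     (fst x = fst y \<and> H (snd x) (snd y)) \<or> (snd x = snd y \<and> G (fst x) (fst y))"

definition strong_prod :: "('a \<Rightarrow> 'a \<Rightarrow> bool) \<Rightarrow> ('b \<Rightarrow> 'b \<Rightarrow> bool)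
    \<Rightarrow> ('a \<times> 'b) \<Rightarrow> ('a \<times> 'b) \<Rightarrow> bool" where
  "strong_prod G H x y \<longleftrightarrow>
     (fst x = fst y \<and> H (snd x) (snd y)) \<or> (snd x = snd y \<and> G (fst x) (fst y))
     \<or> (G (fst x) (fst y) \<and> H (snd x) (snd y))"

definition is_path :: "('a \<Rightarrow> 'a \<Rightarrow> bool) \<Rightarrow> 'a list \<Rightarrow> bool" where
  "is_path G vs \<longleftrightarrow> vs \<noteq> [] \<and> distinct vs \<and> (\<forall>i. Suc i < length vs \<longrightarrow> G (vs ! i) (vs ! Suc i))"

definition nonrepetitive :: "('a \<Rightarrow> 'a \<Rightarrow> bool) \<Rightarrow> ('a \<Rightarrow> 'c) \<Rightarrow> bool" where
  "nonrepetitive G f \<longleftrightarrow>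
     \<not> (\<exists>vs k. k \<ge> 1 \<and> is_path G vs \<and> length vs = 2 * k \<and>
            (\<forall>i<k. f (vs ! i) = f (vs ! (k + i))))"

text \<open>Thue number: least number of colours of a non-repetitive colouring
  (infinity if none exists).\<close>
definition thue_number :: "('a \<Rightarrow> 'a \<Rightarrow> bool) \<Rightarrow> enat" where
  "thue_number G = Inf {enat k | k. \<exists>f :: 'a \<Rightarrow> nat. f ` UNIV \<subseteq> {..<k} \<and> nonrepetitive G f}"

end

theory Submission
  imports Defs
begin

text \<open>
  Suppose the strong grid has a non-repetitive colouring with 8 colours. A finite case analysis
  shows that two vertices of squared distance 4 (one is the other shifted by \<open>(2, 0)\<close>) get different
  colours; using this, squared distance 5 is excluded as well, and then 8. Hence the nine vertices
  of a \<open>3 \<times> 3\<close> block have distinct colours, a contradiction. For the Cartesian grid and 5 colours,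
  squared distances 2 and 4 are excluded in the same way, after which a short case analysis finishes
  the proof; to keep the analysis of distance 2 small, three configurations of equally coloured
  vertices are excluded before it.

  Each case analysis is a tree whose inner nodes branch over the colour of a vertex, up to
  renaming of colours, and whose leaves name a reason for contradiction, typically a repetitive
  path. The trees below were found by a heuristic search.
\<close>

text \<open>If \<open>u\<close> and \<open>v\<close> have the same colour and \<open>a\<close>,
  \<open>b\<close> are two common neighbours, then \<open>a\<close> and \<open>b\<close> get
  different colours, because u, a, v, b is a path. So assuming equal colours is a strong hypothesis
  when many common neighbours exist, and the distances are excluded in order of decreasing number of
  common neighbours: in the strong grid the shifts (2, 0), (2, 1), (2, 2) leave 3, 2, 1 of them, in
  the Cartesian grid (1, 1) and (2, 0) leave 2 and 1. An excluded distance closes branches of the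
  later trees at once, which makes up for the weaker hypothesis there.

  The trees are not trusted. A checker defined in the logic is proved sound, and its run on each
  tree is evaluated by rewriting. A tree mentions only finitely many vertices around one fixed pair;
  isometries of the grid carry its conclusion to every pair in the same relative position.\<close>

section \<open>Grid adjacency and its symmetries\<close>

type_synonym vertex = "int \<times> int"

text \<open>One flag selects the graph, so that the checker and its soundness proof serve both
  bounds. The strong grid is the graph of king moves; \<open>rook\<close> in later names stands for
  the single horizontal or vertical steps of the Cartesian grid.\<close>

definition grid :: "bool \<Rightarrow> vertex \<Rightarrow> vertex \<Rightarrow> bool" where
  "grid king = (if king then strong_prod path_graph path_graph else cart_prod path_graph path_graph)"

fun sqdist :: "vertex \<Rightarrow> vertex \<Rightarrow> int" where
  "sqdist (x, y) (x', y') = (x - x') * (x - x') + (y - y') * (y - y')"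

lemma square_eq_one_iff: "(a::int) * a = 1 \<longleftrightarrow> \<bar>a\<bar> = 1"
  by (metis abs_1 abs_mult_self_eq abs_square_eq_1 power2_eq_square)

text \<open>The square of an integer is 0, 1 or at least 4, so a bound of 1 or 2 on the squared
  distance leaves only coordinate differences of absolute value at most 1. With adjacency as a
  distance threshold, an injective isometry automatically preserves edges.\<close>

lemma grid_iff: "grid king u v \<longleftrightarrow> u \<noteq> v \<and> sqdist u v \<le> (if king then 2 else 1)"
proof (cases u; cases v)
  fix x y x' y' assume uv: "u = (x, y)" "v = (x', y')"
  define a b where "a = x - x'" and "b = y - y'"
  have sq: "\<bar>c\<bar> = 0 \<or> \<bar>c\<bar> = 1 \<or> c * c \<ge> 4" for c :: int
  proof -
    have "\<bar>c\<bar> \<ge> 2 \<Longrightarrow> \<bar>c\<bar> * \<bar>c\<bar> \<ge> 2 * 2" by (rule mult_mono) auto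
    then show ?thesis by fastforce
  qed
  have nn: "a * a \<ge> 0" "b * b \<ge> 0" by simp_all
  have one: "\<bar>c\<bar> = 1 \<Longrightarrow> c * c = 1" for c :: int using square_eq_one_iff by blast
  have "(if king then (a = 0 \<and> \<bar>b\<bar> = 1) \<or> (b = 0 \<and> \<bar>a\<bar> = 1) \<or> (\<bar>a\<bar> = 1 \<and> \<bar>b\<bar> = 1)
      else (a = 0 \<and> \<bar>b\<bar> = 1) \<or> (b = 0 \<and> \<bar>a\<bar> = 1)) \<longleftrightarrow>
    \<not> (a = 0 \<and> b = 0) \<and> a * a + b * b \<le> (if king then 2 else 1)"
    using sq[of a] sq[of b] nn one[of a] one[of b] by auto
  then show ?thesis
    by (auto simp: grid_def strong_prod_def cart_prod_def path_graph_def uv a_def b_def split: if_splits)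
qed

text \<open>The symmetries of the square, indexed by three bits of \<open>s\<close>, followed by a translation.\<close>

fun move :: "nat \<Rightarrow> vertex \<Rightarrow> vertex \<Rightarrow> vertex" where
  "move s (a, b) (x, y) =
     (let x' = (if odd s then - x else x); y' = (if odd (s div 2) then - y else y)
      in if odd (s div 4) then (y' + a, x' + b) else (x' + a, y' + b))"

lemma sqdist_move: "sqdist (move s a u) (move s a v) = sqdist u v"
  by (cases a; cases u; cases v) (auto simp: Let_def algebra_simps)

lemma inj_move: "inj (move s a)"
  by (cases a) (auto simp: inj_def Let_def split: if_splits)

text \<open>The map \<open>h\<close> sends a repetitive path of \<open>f \<circ> h\<close> to one of
  \<open>f\<close>; injectivity keeps its vertices distinct.\<close>

lemma nonrepetitive_comp:
  assumes f: "nonrepetitive G f" and "inj h" and hom: "\<And>u v. G u v \<Longrightarrow> G (h u) (h v)"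
  shows "nonrepetitive G (f \<circ> h)"
  unfolding nonrepetitive_def
proof clarify
  fix vs k assume k: "1 \<le> k" "is_path G vs" "length vs = 2 * k"
    "\<forall>i<k. (f \<circ> h) (vs ! i) = (f \<circ> h) (vs ! (k + i))"
  have "is_path G (map h vs)"
    using k(2) \<open>inj h\<close> hom by (auto simp: is_path_def distinct_map intro: inj_on_subset)
  moreover have "\<forall>i<k. f (map h vs ! i) = f (map h vs ! (k + i))" using k(3,4) by auto
  ultimately show False using f k(1,3) unfolding nonrepetitive_def by (metis length_map)
qed

lemma nonrepetitive_move:
  "nonrepetitive (grid king) f \<Longrightarrow> nonrepetitive (grid king) (f \<circ> move s a)"
  by (rule nonrepetitive_comp) (auto simp: inj_move grid_iff sqdist_move dest: injD[OF inj_move])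

section \<open>Walks given by directions\<close>

datatype dir = E | W | N | S | NE | NW | SE | SW

fun step :: "dir \<Rightarrow> vertex \<Rightarrow> vertex" where
  "step E (x, y) = (x + 1, y)"
| "step W (x, y) = (x - 1, y)"
| "step N (x, y) = (x, y + 1)"
| "step S (x, y) = (x, y - 1)"
| "step NE (x, y) = (x + 1, y + 1)"
| "step NW (x, y) = (x - 1, y + 1)"
| "step SE (x, y) = (x + 1, y - 1)"
| "step SW (x, y) = (x - 1, y - 1)"

fun diagonal :: "dir \<Rightarrow> bool" where
  "diagonal E = False"
| "diagonal W = False"
| "diagonal N = False"
| "diagonal S = False"
| "diagonal NE = True"
| "diagonal NW = True"
| "diagonal SE = True"
| "diagonal SW = True"

text \<open>Storing a path as a start and directions makes consecutive vertices adjacent by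
  construction. What is left to test is distinctness and, in the Cartesian grid, the absence of
  diagonal steps.\<close>

fun walk :: "vertex \<Rightarrow> dir list \<Rightarrow> vertex list" where
  "walk v [] = [v]"
| "walk v (d # ds) = v # walk (step d v) ds"

lemma walk_not_Nil [simp]: "walk v ds \<noteq> []"
  by (cases ds) auto

lemma walk_nth_0: "walk v ds ! 0 = v"
  by (cases ds) auto

lemma grid_step: "king \<or> \<not> diagonal d \<Longrightarrow> grid king v (step d v)"
  by (cases v; cases d) (auto simp: grid_iff)

lemma is_path_walk:
  assumes "king \<or> \<not> list_ex diagonal ds" and "distinct (walk v ds)"
  shows "is_path (grid king) (walk v ds)"
proof -
  have "grid king (walk v ds ! i) (walk v ds ! Suc i)" if "Suc i < length (walk v ds)" for i
    using assms(1) that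
  proof (induction ds arbitrary: v i)
    case (Cons d ds)
    show ?case
    proof (cases i)
      case 0
      then show ?thesis using Cons.prems by (auto simp: walk_nth_0 grid_step)
    next
      case (Suc j)
      then show ?thesis using Cons.prems Cons.IH[where i = j and v = "step d v"] by auto
    qed
  qed simp
  then show ?thesis using assms(2) by (simp add: is_path_def)
qed

section \<open>Case trees and their checker\<close>

text \<open>
  Leaves: \<open>X\<close> -- the vertex coloured last is too close to another one of its colour; \<open>H\<close> -- one of the
  assumed equations is violated; \<open>P x y ds\<close> -- the walk from \<open>(x, y)\<close> along \<open>ds\<close> is a repetitive path;
  \<open>Q i s a b\<close> -- the image of the \<open>i\<close>-th excluded configuration under \<open>move s (a, b)\<close> occurs.
  \<open>B x y ts\<close> branches over the colour of \<open>(x, y)\<close>: one subtree for each colour in use, in order of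
  first use, and one for a fresh colour if any is left.
\<close>

datatype cert = X | H | P int int "dir list" | Q nat nat int int | B int int "cert list"

type_synonym assignment = "(vertex \<times> nat) list"
type_synonym equations = "(vertex \<times> vertex) list"

fun same :: "assignment \<Rightarrow> vertex \<Rightarrow> vertex \<Rightarrow> bool" where
  "same \<sigma> u v = (case map_of \<sigma> u of None \<Rightarrow> False | Some c \<Rightarrow> map_of \<sigma> v = Some c)"

text \<open>Not the negation of \<open>same\<close>: both are false as soon as one of the vertices
  is uncoloured, so a leaf is accepted only on the basis of colours already chosen.\<close>

fun differ :: "assignment \<Rightarrow> vertex \<Rightarrow> vertex \<Rightarrow> bool" where
  "differ \<sigma> u v = (case map_of \<sigma> u of None \<Rightarrow> False | Some c \<Rightarrow>
      (case map_of \<sigma> v of None \<Rightarrow> False | Some c' \<Rightarrow> c \<noteq> c'))"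

text \<open>\<open>m\<close> counts the colours in use, \<open>r\<close> is a squared distance up to
  which equal colours are already excluded, \<open>pats\<close> lists the excluded configurations
  and \<open>eqs\<close> the assumed equations. In \<open>min (Suc m) C\<close> the extra subtree
  for a fresh colour disappears once all \<open>C\<close> colours are used;
  \<open>max m (Suc i)\<close> raises the counter only for the fresh colour
  \<open>i = m\<close>.\<close>

fun refutes :: "bool \<Rightarrow> nat \<Rightarrow> int \<Rightarrow> equations list \<Rightarrow> equations \<Rightarrow> cert \<Rightarrow> assignment \<Rightarrow> nat \<Rightarrow> bool"
and refutes_all :: "bool \<Rightarrow> nat \<Rightarrow> int \<Rightarrow> equations list \<Rightarrow> equations \<Rightarrow> cert list \<Rightarrow> vertex \<Rightarrow> nat
    \<Rightarrow> assignment \<Rightarrow> nat \<Rightarrow> bool" where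
  "refutes king C r pats eqs X \<sigma> m =
     (case \<sigma> of [] \<Rightarrow> False
      | (v, c) # \<sigma>' \<Rightarrow> list_ex (\<lambda>(w, c'). c' = c \<and> v \<noteq> w \<and> sqdist v w \<le> r) \<sigma>')"
| "refutes king C r pats eqs H \<sigma> m = list_ex (\<lambda>(u, v). differ \<sigma> u v) eqs"
| "refutes king C r pats eqs (P x y ds) \<sigma> m =
     (let vs = walk (x, y) ds; k = length vs div 2 in
      (king \<or> \<not> list_ex diagonal ds) \<and> distinct vs \<and> even (length vs) \<and>
        list_all2 (same \<sigma>) (take k vs) (drop k vs))"
| "refutes king C r pats eqs (Q i s a b) \<sigma> m =
     (i < length pats \<and> list_all (\<lambda>(u, v). same \<sigma> (move s (a, b) u) (move s (a, b) v)) (pats ! i))"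
| "refutes king C r pats eqs (B x y ts) \<sigma> m =
     (length ts = min (Suc m) C \<and> refutes_all king C r pats eqs ts (x, y) 0 \<sigma> m)"
| "refutes_all king C r pats eqs [] v i \<sigma> m = True"
| "refutes_all king C r pats eqs (t # ts) v i \<sigma> m =
     (refutes king C r pats eqs t ((v, i) # \<sigma>) (max m (Suc i)) \<and>
      refutes_all king C r pats eqs ts v (Suc i) \<sigma> m)"

section \<open>Soundness of the checker\<close>

text \<open>Colours are numbered by first use; \<open>g\<close> translates these numbers into the colours of \<open>f\<close>.\<close>

definition represents :: "(nat \<Rightarrow> nat) \<Rightarrow> (vertex \<Rightarrow> nat) \<Rightarrow> assignment \<Rightarrow> nat \<Rightarrow> bool" where
  "represents g f \<sigma> m \<longleftrightarrow> inj_on g {..<m} \<and> g ` {..<m} \<subseteq> range f \<and>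
     (\<forall>(v, c) \<in> set \<sigma>. c < m \<and> f v = g c)"

lemma represents_lookup:
  "represents g f \<sigma> m \<Longrightarrow> map_of \<sigma> v = Some c \<Longrightarrow> c < m \<and> f v = g c"
  by (auto simp: represents_def dest: map_of_SomeD)

lemma same_eq: "represents g f \<sigma> m \<Longrightarrow> same \<sigma> u v \<Longrightarrow> f u = f v"
  using represents_lookup[of g f \<sigma> m u] represents_lookup[of g f \<sigma> m v]
  by (auto split: option.splits)

text \<open>Unlike for \<open>same_eq\<close>, the injectivity of \<open>g\<close> matters here:
  different numbers have to stand for different colours.\<close>

lemma differ_neq:
  assumes "represents g f \<sigma> m" and "differ \<sigma> u v"
  shows "f u \<noteq> f v"
proof -
  obtain c c' where "map_of \<sigma> u = Some c" "map_of \<sigma> v = Some c'" "c \<noteq> c'"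
    using assms(2) by (auto split: option.splits)
  moreover have "inj_on g {..<m}" using assms(1) by (simp add: represents_def)
  ultimately show ?thesis
    using represents_lookup[OF assms(1)] by (metis inj_onD lessThan_iff)
qed

lemma represents_old:
  "represents g f \<sigma> m \<Longrightarrow> i < m \<Longrightarrow> f v = g i \<Longrightarrow> represents g f ((v, i) # \<sigma>) m"
  by (auto simp: represents_def)

lemma represents_new:
  assumes "represents g f \<sigma> m" and "f v \<notin> g ` {..<m}"
  shows "represents (g(m := f v)) f ((v, m) # \<sigma>) (Suc m)"
proof -
  have "inj_on (g(m := f v)) {..<Suc m}"
    using assms by (auto simp: represents_def lessThan_Suc inj_on_fun_updI)
  then show ?thesis
    using assms by (fastforce simp: represents_def less_Suc_eq)
qed

lemma refutes_all_nth:
  "refutes_all king C r pats eqs ts v i \<sigma> m \<Longrightarrow> j < length ts \<Longrightarrow>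
   refutes king C r pats eqs (ts ! j) ((v, i + j) # \<sigma>) (max m (Suc (i + j)))"
proof (induction ts arbitrary: i j)
  case (Cons t ts)
  then show ?case by (cases j) (auto dest: Cons.IH[of "Suc i"])
qed simp

text \<open>At each branching the actual colour of the vertex under \<open>f\<close> selects one
  subtree, and the partial assignment stays a description of \<open>f\<close>; the leaf reached in
  this way would contradict one of the hypotheses. The translation \<open>g\<close> is generalised
  in the induction, since it grows whenever a fresh colour is met. A single fresh subtree suffices
  because any colour not yet numbered may receive the number \<open>m\<close>.\<close>

lemma refutes_sound:
  fixes f :: "vertex \<Rightarrow> nat"
  assumes nonrep: "nonrepetitive (grid king) f"
    and col: "range f \<subseteq> {..<C}"
    and far: "\<And>u v. u \<noteq> v \<Longrightarrow> sqdist u v \<le> r \<Longrightarrow> f u \<noteq> f v"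
    and pats: "\<And>p s a. p \<in> set pats \<Longrightarrow> \<exists>(u, v) \<in> set p. f (move s a u) \<noteq> f (move s a v)"
    and eqs: "\<And>u v. (u, v) \<in> set eqs \<Longrightarrow> f u = f v"
  shows "represents g f \<sigma> m \<Longrightarrow> \<not> refutes king C r pats eqs t \<sigma> m"
proof (induction t arbitrary: g \<sigma> m)
  case X
  show ?case
  proof (cases \<sigma>)
    case (Cons p \<sigma>')
    obtain v c where p: "p = (v, c)" by (cases p)
    have "\<not> (v \<noteq> w \<and> sqdist v w \<le> r)" if "(w, c) \<in> set \<sigma>'" for w
      using X far[of v w] that unfolding represents_def Cons p by auto
    then show ?thesis
      unfolding refutes.simps Cons p list.case prod.case list_ex_iff by blast
  qed simp
next
  case H
  show ?case
  proof
    assume "refutes king C r pats eqs H \<sigma> m"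
    then obtain u v where "(u, v) \<in> set eqs" "differ \<sigma> u v"
      unfolding refutes.simps list_ex_iff by blast
    then show False using eqs differ_neq[OF H] by blast
  qed
next
  case (P x y ds)
  show ?case
  proof
    assume r: "refutes king C r pats eqs (P x y ds) \<sigma> m"
    define vs where "vs = walk (x, y) ds"
    define k where "k = length vs div 2"
    have 1: "is_path (grid king) vs" and 2: "length vs = 2 * k"
      and 3: "list_all2 (same \<sigma>) (take k vs) (drop k vs)"
      using r is_path_walk by (auto simp: Let_def vs_def k_def simp del: same.simps)
    \<comment> \<open>A walk has at least one vertex, which rules out the empty repetition.\<close>
    have "k \<ge> 1" using 1 2 by (cases k) (auto simp: is_path_def)
    moreover have "f (vs ! i) = f (vs ! (k + i))" if "i < k" for i
      using list_all2_nthD[OF 3, of i] that 2 same_eq[OF P] by (simp del: same.simps)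
    ultimately show False using nonrep 1 2 unfolding nonrepetitive_def by blast
  qed
next
  case (Q i s a b)
  show ?case
  proof
    assume r: "refutes king C r pats eqs (Q i s a b) \<sigma> m"
    then have "pats ! i \<in> set pats" by simp
    then obtain u v where "(u, v) \<in> set (pats ! i)" "f (move s (a, b) u) \<noteq> f (move s (a, b) v)"
      using pats by blast
    then show False using r same_eq[OF Q, of "move s (a, b) u" "move s (a, b) v"]
      by (auto simp: list_all_iff simp del: same.simps move.simps)
  qed
next
  case (B x y ts)
  let ?v = "(x, y)"
  have fin: "finite (range f)" using col finite_subset by blast
  have C: "card (range f) \<le> C" using card_mono[OF _ col] by simp
  \<comment> \<open>Only colours that occur in \<open>f\<close> are numbered, so the
    \<open>m\<close> numbers stand for \<open>m\<close> distinct elements of a range with at most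
    \<open>C\<close> elements. This count guarantees in both cases below that the required subtree
    exists.\<close>
  have g: "card (g ` {..<m}) = m" "g ` {..<m} \<subseteq> range f"
    using B.prems by (auto simp: represents_def card_image)
  show ?case
  proof
    assume r: "refutes king C r pats eqs (B x y ts) \<sigma> m"
    then have len: "length ts = min (Suc m) C" and
      all: "\<And>j. j < length ts \<Longrightarrow>
        refutes king C r pats eqs (ts ! j) ((?v, j) # \<sigma>) (max m (Suc j))"
      using refutes_all_nth[of king C r pats eqs ts ?v 0 \<sigma> m] by auto
    show False
    proof (cases "f ?v \<in> g ` {..<m}")
      case True
      then obtain j where j: "j < m" "f ?v = g j" by auto
      moreover have "m \<le> C" using g C card_mono[OF fin g(2)] by simp
      ultimately have jl: "j < length ts" using len by simp
      \<comment> \<open>A colour already in use leaves the counter unchanged.\<close>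
      have "max m (Suc j) = m" using j(1) by simp
      then show False
        using B.IH[OF nth_mem[OF jl] represents_old[OF B.prems j]] all[OF jl] by simp
    next
      case False
      \<comment> \<open>The new colour and the \<open>m\<close> old ones all occur in
        \<open>f\<close>, hence \<open>m < C\<close> and the tree has its subtree for a fresh
        colour, at position \<open>m\<close>.\<close>
      have "card (insert (f ?v) (g ` {..<m})) \<le> card (range f)"
        using g(2) fin by (intro card_mono) auto
      then have "Suc m \<le> C" using g(1) C False by simp
      then have ml: "m < length ts" using len by simp
      show False
        using B.IH[OF nth_mem[OF ml] represents_new[OF B.prems False]] all[OF ml] by simp
    qed
  qed
qed

section \<open>Excluded configurations and distances\<close>

text \<open>Quantifying over all colourings allows the statement to be applied to a colouring
  composed with a symmetry. For \<open>eqs = []\<close> it says that no non-repetitive colouring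
  with \<open>C\<close> colours exists.\<close>

definition forbidden :: "bool \<Rightarrow> nat \<Rightarrow> equations \<Rightarrow> bool" where
  "forbidden king C eqs \<longleftrightarrow> (\<forall>f. nonrepetitive (grid king) f \<longrightarrow> range f \<subseteq> {..<C} \<longrightarrow>
     (\<exists>(u, v) \<in> set eqs. f u \<noteq> f v))"

definition separated :: "bool \<Rightarrow> nat \<Rightarrow> int \<Rightarrow> bool" where
  "separated king C r \<longleftrightarrow> (\<forall>f u v. nonrepetitive (grid king) f \<longrightarrow> range f \<subseteq> {..<C} \<longrightarrow>
     u \<noteq> v \<longrightarrow> sqdist u v \<le> r \<longrightarrow> f u \<noteq> (f v :: nat))"

lemma forbidden_move:
  assumes "forbidden king C eqs" "nonrepetitive (grid king) f" "range f \<subseteq> {..<C}"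
  shows "\<exists>(u, v) \<in> set eqs. f (move s a u) \<noteq> f (move s a v)"
proof -
  have "nonrepetitive (grid king) (f \<circ> move s a)" "range (f \<circ> move s a) \<subseteq> {..<C}"
    using assms nonrepetitive_move[of king f s a] by auto
  then have "\<exists>(u, v) \<in> set eqs. (f \<circ> move s a) u \<noteq> (f \<circ> move s a) v"
    using assms(1) unfolding forbidden_def by blast
  then show ?thesis unfolding comp_apply .
qed

lemma forbidden_by_cert:
  assumes "separated king C r" and pats: "list_all (forbidden king C) pats"
    and ref: "refutes king C r pats eqs t [] 0"
  shows "forbidden king C eqs"
  unfolding forbidden_def
proof (intro allI impI, rule ccontr)
  fix f assume f: "nonrepetitive (grid king) f" "range f \<subseteq> {..<C}"
    and eq: "\<not> (\<exists>(u, v)\<in>set eqs. f u \<noteq> f v)"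
  \<comment> \<open>At the root no colour has a number yet, so any translation would do.\<close>
  have "represents id f [] 0" by (simp add: represents_def)
  moreover have "f u \<noteq> f v" if "u \<noteq> v" "sqdist u v \<le> r" for u v
    using assms(1) f that unfolding separated_def by blast
  moreover have "\<exists>(u, v) \<in> set p. f (move s a u) \<noteq> f (move s a v)" if "p \<in> set pats" for p s a
    using forbidden_move[OF _ f] pats that unfolding list_all_iff by blast
  moreover have "f u = f v" if "(u, v) \<in> set eqs" for u v using eq that by auto
  ultimately show False using refutes_sound[OF f] ref by blast
qed

text \<open>An edge with equally coloured ends is a repetitive path with \<open>k = 1\<close>. This
  is the starting radius for both grids.\<close>

lemma separated_adjacent: "separated king C (if king then 2 else 1)"
  unfolding separated_def
proof (intro allI impI notI)
  fix f u v assume f: "nonrepetitive (grid king) f" and "u \<noteq> v" "sqdist u v \<le> (if king then 2 else 1)"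
    and eq: "f u = (f v :: nat)"
  then have "is_path (grid king) [u, v]" by (auto simp: is_path_def grid_iff)
  then show False using f eq unfolding nonrepetitive_def
    by (auto dest!: spec[of _ "[u, v]"] spec[of _ 1])
qed

text \<open>Up to translation a pair of vertices is its difference vector, and sign changes and the
  swap of coordinates leave exactly the unordered pair of absolute values invariant.\<close>

lemma exists_move:
  assumes "{\<bar>a - c\<bar>, \<bar>b - d\<bar>} = {\<bar>x - x'\<bar>, \<bar>y - y'\<bar>}"
  shows "\<exists>s e. move s e (a, b) = (x, y) \<and> move s e (c, d) = (x', y')"
proof -
  \<comment> \<open>It is enough to match the difference vectors by a linear symmetry; the
    translation is then determined by the first vertex.\<close>
  have sub: "\<exists>s e. move s e (a, b) = (x, y) \<and> move s e (c, d) = (x', y')"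
    if "move s (0, 0) (a - c, b - d) = (x - x', y - y')" for s
  proof -
    obtain p q where pq: "move s (0, 0) (a, b) = (p, q)" by fastforce
    have "move s (x - p, y - q) (a, b) = (x, y)" "move s (x - p, y - q) (c, d) = (x', y')"
      using that pq by (auto simp: Let_def split: if_splits)
    then show ?thesis by blast
  qed
  consider "\<bar>a - c\<bar> = \<bar>x - x'\<bar>" "\<bar>b - d\<bar> = \<bar>y - y'\<bar>"
    | "\<bar>a - c\<bar> = \<bar>y - y'\<bar>" "\<bar>b - d\<bar> = \<bar>x - x'\<bar>"
    using assms by (auto simp: doubleton_eq_iff)
  then show ?thesis
  proof cases
    case 1
    show ?thesis
      \<comment> \<open>Bits 1 and 2 of the index negate the first and the second coordinate; each
        is set when the signs disagree.\<close>
      by (rule sub[of "(if a - c = x - x' then 0 else 1) + (if b - d = y - y' then 0 else 2)"])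
        (use 1 in \<open>auto simp: abs_eq_iff\<close>)
  next
    case 2
    show ?thesis
      \<comment> \<open>The swap adds 4. Negations act before the swap, so \<open>a - c\<close> is
        compared with \<open>y - y'\<close>.\<close>
      by (rule sub[of "(if a - c = y - y' then 4 else 5) + (if b - d = x - x' then 0 else 2)"])
        (use 2 in \<open>auto simp: abs_eq_iff\<close>)
  qed
qed

text \<open>Enlarges the radius by one class of pairs under the symmetries, represented by
  \<open>(a, b)\<close> and \<open>(c, d)\<close>. As 3, 6 and 7 are not sums of two squares, the
  steps from 2 to 4, 4 to 5 and 5 to 8 each add only one class. Below 9, coordinate differences lie
  between -2 and 2, so the last hypothesis is a finite check.\<close>

lemma separated_extend:
  assumes "separated king C r" and "forbidden king C [((a, b), (c, d))]" and "r' < 9"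
    and "\<forall>x\<in>{-2,-1,0,1,2}. \<forall>y\<in>{-2,-1,0,1,2}.
      r < x * x + y * y \<longrightarrow> x * x + y * y \<le> r' \<longrightarrow> {\<bar>a - c\<bar>, \<bar>b - d\<bar>} = {\<bar>x\<bar>, \<bar>y\<bar>}"
  shows "separated king C r'"
  unfolding separated_def
proof (intro allI impI)
  fix f u v assume f: "nonrepetitive (grid king) f" "range f \<subseteq> {..<C}"
    and "u \<noteq> v" and le: "sqdist u v \<le> r'"
  obtain x y x' y' where uv: "u = (x, y)" "v = (x', y')" by fastforce
  show "f u \<noteq> f v"
  proof (cases "sqdist u v \<le> r")
    case True
    then show ?thesis using assms(1) f \<open>u \<noteq> v\<close> unfolding separated_def by blast
  next
    case False
    have small: "z \<in> {-2,-1,0,1,2}" if "z * z < 9" for z :: int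
    proof -
      have "\<bar>z\<bar> * \<bar>z\<bar> < 9" using that by simp
      then have "\<bar>z\<bar> < 3" using mult_mono[of 3 "\<bar>z\<bar>" 3 "\<bar>z\<bar>"] by linarith
      then show ?thesis by auto
    qed
    have "(x - x') * (x - x') \<ge> 0" "(y - y') * (y - y') \<ge> 0" by simp_all
    then have "x - x' \<in> {-2,-1,0,1,2}" "y - y' \<in> {-2,-1,0,1,2}"
      using le \<open>r' < 9\<close> unfolding uv sqdist.simps by (intro small; linarith)+
    then have "{\<bar>a - c\<bar>, \<bar>b - d\<bar>} = {\<bar>x - x'\<bar>, \<bar>y - y'\<bar>}"
      using assms(4) le False unfolding uv sqdist.simps by (meson not_le)
    then obtain s e where "move s e (a, b) = u" "move s e (c, d) = v"
      using exists_move uv by blast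
    then show ?thesis using forbidden_move[OF assms(2) f, of s e] by auto
  qed
qed

text \<open>A colouring with \<open>k \<le> C\<close> colours is also one into
  \<open>{..<C}\<close>, so every \<open>k\<close> in the defining set exceeds \<open>C\<close>;
  this also covers an empty set, whose infimum is infinite.\<close>

lemma thue_number_gt:
  assumes "forbidden king C []"
  shows "thue_number (grid king) > enat C"
proof -
  have "enat (Suc C) \<le> thue_number (grid king)"
    unfolding thue_number_def
  proof (rule Inf_greatest, clarify)
    fix k and f :: "vertex \<Rightarrow> nat" assume f: "range f \<subseteq> {..<k}" "nonrepetitive (grid king) f"
    have "\<not> range f \<subseteq> {..<C}" using assms f(2) by (auto simp: forbidden_def)
    then have "\<not> k \<le> C" using f(1) by fastforce
    then show "enat (Suc C) \<le> enat k" by simp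
  qed
  then show ?thesis by (simp add: Suc_ile_eq)
qed


subsection \<open>The strong grid\<close>

lemma king_separated_2: "separated True 8 2"
  using separated_adjacent[of True 8] by simp

text \<open>The first two nodes colour the assumed pair: the second has one subtree for equal
  colours and \<open>H\<close> for different ones. The common neighbours (4, 4), (4, 3) and (4, 5)
  are then forced to take three further colours, the last one by the path
  \<open>P 3 4 [NE,SE,SW]\<close>. Later trees with an equation begin with its vertices in the same
  way.\<close>

definition king_cert_4 :: cert where
  "king_cert_4 =
    B 3 4 [B 5 4 [B 4 4 [X, B 4 3 [X, X, B 4 5 [X, X, P 3 4 [NE,SE,SW], B 2 4 [X, P 5 4 [W,W,W], P
     5 4 [SW,NW,W], P 5 4 [NW,SW,W], B 3 3 [X, X, X, P 5 4 [NW,SW,S], X, B 2 3 [X, P 5 4 [W,W,SW],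
     P 5 4 [SW,NW,SW], P 5 4 [NW,SW,SW], X, X, B 3 5 [X, X, P 5 4 [SW,NW,N], X, X, B 2 2 [P 3 5
     [S,S,SW], P 3 5 [SE,SW,SW], B 3 2 [P 2 2 [E,NE,NW], P 2 2 [E,NE,N], X, B 4 2 [P 3 5 [S,S,SE],
     P 3 5 [SE,SW,SE], X, X, P 3 5 [SW,SE,SE], X, B 5 3 [X, X, X, P 2 3 [SE,E,NE], P 5 4
     [S,SW,N,NW,W,S,S], P 2 3 [E,SE,NE], X, B 3 1 [P 2 3 [S,SE,NE,N,NW], P 2 3 [S,SE,NE,N,N], X,
     X, P 4 3 [S,SW,NW,N,N], P 4 3 [W,SW,SE], X, P 2 3 [S,SE,NE,N,E]]], B 5 3 [X, X, X, P 2 2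
     [E,NE,E], B 2 5 [X, P 5 4 [W,W,NW], P 5 4 [SW,NW,NW], P 5 4 [NW,SW,NW], X, X, B 1 3 [P 2 5
     [SE,SW,W], P 5 4 [S,NW,W,W,SW], X, P 4 3 [SW,W,NW], X, P 4 3 [W,SW,NW], X, P 5 4
     [S,SW,N,NW,W,SW,SE]], P 3 5 [W,S,SE,SE,NE]], P 2 2 [NE,E,E], P 5 4 [S,W,NW,SW,S], X]], P 3 5
     [SW,SE,S], X, X, B 5 3 [X, X, X, P 3 4 [NE,SE,S], B 4 2 [P 3 5 [S,S,SE], P 3 5 [SE,SW,SE], X,
     B 5 2 [P 3 5 [E,SW,S,SE,E], P 3 5 [E,S,SW,SE,E], X, X, X, P 2 2 [NE,E,SE], P 5 4
     [S,S,NW,NW,W,S,S], P 2 2 [E,NE,SE]], X, X, P 5 4 [S,SW,N,NW,W,S,S], X], P 2 2 [NE,E,E], P 5 4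
     [S,W,NW,SW,S], P 2 2 [E,NE,E]]], B 3 2 [P 3 5 [S,S,S], P 3 5 [SE,SW,S], X, X, P 3 5
     [SW,SE,S], X, X, B 4 2 [P 3 5 [S,S,SE], P 3 5 [SE,SW,SE], X, B 1 3 [P 3 5 [E,SW,S,SW,NW], P 3
     5 [E,S,SW,SW,NW], B 5 3 [X, X, X, X, P 5 4 [S,W,NW,W,SW], P 2 2 [NE,SE,NE], P 5 4
     [S,W,NW,SW,W], P 2 2 [E,E,NE]], X, X, P 4 2 [NW,SW,NW], X, P 4 2 [W,W,NW]], P 3 5 [SW,SE,SE],
     X, B 5 3 [X, X, X, P 3 4 [NE,SE,S], B 1 3 [P 3 5 [E,SW,S,SW,NW], P 3 5 [E,S,SW,SW,NW], P 5 4
     [S,W,NW,W,SW], X, X, P 4 2 [NW,W,W], X, P 4 2 [W,NW,W]], P 2 3 [E,SE,NE], X, P 2 3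
     [SE,E,NE]], X]], P 3 5 [SW,SE,SW], X, X, B 3 2 [P 3 5 [S,S,S], P 3 5 [SE,SW,S], X, B 4 2 [P 3
     5 [S,S,SE], P 3 5 [SE,SW,SE], X, X, P 3 5 [SW,SE,SE], X, B 5 3 [X, X, X, P 2 3 [SE,E,NE], B 2
     5 [X, P 5 4 [W,W,NW], P 5 4 [SW,NW,NW], P 5 4 [NW,SW,NW], X, X, P 3 5 [W,S,SE,SE,NE], B 1 3
     [P 3 5 [W,SE,S,SW,NW], P 5 4 [S,NW,W,W,SW], P 5 4 [S,W,NW,W,SW], P 4 2 [W,NW,W], X, P 4 2
     [NW,W,W], X, X]], P 2 3 [E,SE,NE], X, B 3 1 [P 3 5 [E,SW,S,S,S], P 2 3 [S,SE,NE,NE,NW], P 2 3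
     [S,SE,NE,NE,W], X, P 5 3 [SW,SW,NW,N,N], P 2 3 [E,SE,SW], X, X]], B 3 1 [P 3 5 [E,SW,S,S,S],
     P 3 5 [E,S,SW,S,S], P 2 2 [SE,NE,N], X, B 5 3 [X, X, X, P 2 2 [E,E,NE], P 2 2 [SE,NE,NE], P 2
     2 [NE,SE,NE], B 2 5 [X, P 5 4 [W,W,NW], P 5 4 [SW,NW,NW], P 5 4 [NW,SW,NW], X, X, B 1 4 [P 2
     3 [NW,NE,SE], P 5 4 [S,NW,W,SW,NW], P 5 4 [S,W,NW,SW,NW], P 2 5 [SW,SE,SE], X, P 2 5
     [SW,SE,E], X, P 2 5 [SW,SE,S]], P 3 5 [W,S,SE,SW,SE]], X], P 2 2 [SE,NE,NW], P 4 2 [SW,NW,N],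
     X]], P 3 5 [SW,SE,S], X, X, X]], B 3 2 [P 3 5 [S,SW,SE], B 2 5 [X, P 5 4 [W,W,NW], P 5 4
     [SW,NW,NW], P 5 4 [NW,SW,NW], X, P 3 2 [NW,E,NE,NW,W], X, B 3 6 [P 2 3 [NE,N,N], B 5 3 [X, X,
     X, P 3 6 [SE,S,SE], B 4 2 [P 3 5 [SE,W,SW,SE,E], X, X, B 5 5 [X, X, P 3 2 [NE,N,NE], X, P 3 2
     [E,NE,NW,N,E], P 3 2 [N,NE,NE], P 3 6 [S,SE,NE], P 5 4 [N,SW,W,NW,NE]], X, X, P 2 4
     [NE,SE,SE,SW,W], P 5 3 [SW,W,NW,N,N,NE,S]], P 3 2 [N,NE,SE], P 3 6 [S,SE,SE], P 5 4
     [S,NW,W,NW,NE]], B 5 3 [X, X, X, P 3 4 [NE,SE,S], B 4 2 [P 3 5 [SE,W,SW,SE,E], X, X, P 3 6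
     [SE,S,S,S,W], X, X, P 3 6 [S,SE,S,S,W], P 5 4 [S,SW,N,NW,W,N,NE]], P 3 2 [N,NE,SE], P 5 4
     [S,NW,W,SW,SE], P 5 4 [S,W,NW,NW,NE]], X, P 2 3 [N,NE,N], P 3 2 [NW,E,NE,NW,N], X, X]], X, B
     2 2 [P 3 5 [S,SW,S], B 2 5 [X, P 5 4 [W,W,NW], P 5 4 [SW,NW,NW], P 5 4 [NW,SW,NW], X, P 2 2
     [N,E,NE,NW,W], X, B 3 6 [P 2 3 [NE,N,N], B 4 6 [P 2 3 [NE,N,NE], X, P 2 2 [E,NE,N,N,N], X, P
     2 3 [N,NE,NE], P 2 2 [N,E,NE,NW,NE], X, B 5 3 [X, X, X, P 3 6 [SE,S,SE], B 5 5 [X, X, P 3 4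
     [SE,NE,N], X, B 4 2 [P 5 5 [S,S,SW], P 5 5 [SW,SE,SW], X, X, X, X, P 3 4 [W,NE,E,SE,S,SW,W],
     P 5 5 [NW,S,S,SE,SW,W,W]], P 2 2 [NE,NE,NE], P 3 6 [S,SE,NE], X], P 2 2 [NE,NE,SE], P 3 6
     [S,SE,SE], P 5 4 [S,NW,W,NW,NE]]], P 2 2 [E,NE,N,N,NW], X, P 2 3 [N,NE,N], P 2 2
     [N,E,NE,NW,N], X, X]], B 1 3 [P 3 5 [S,SW,W], P 4 5 [W,SE,S,SW,NW,W,SE], X, P 4 3 [SW,W,NW],
     X, P 4 3 [W,SW,NW], X, B 1 2 [P 3 5 [S,SW,SW], P 4 5 [W,SE,S,SW,NW,SW,E], X, P 4 3 [SW,W,W],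
     P 3 5 [SW,S,SW], P 4 3 [W,SW,W], X, X]], X, P 3 5 [SW,S,S], X, X, B 2 5 [X, P 5 4 [W,W,NW], P
     5 4 [SW,NW,NW], P 5 4 [NW,SW,NW], X, B 1 4 [P 3 5 [S,SW,NW], P 3 3 [W,NW,NE,E,SE], P 3 5
     [W,SW,SE,E,E], P 3 5 [W,SW,SE,E,S], X, X, X, P 3 5 [W,SW,SE,E,SW]], X, B 1 4 [P 3 5
     [S,SW,NW], P 2 2 [N,NW,NE,E,SE], B 5 3 [X, X, X, P 3 4 [NE,SE,S], P 5 4 [S,W,NW,W,W], B 4 2
     [P 5 3 [SW,NW,N], P 3 3 [SE,NE,NW], X, X, P 5 3 [SW,NW,NW], X, P 5 3 [SW,NW,W], P 5 3
     [SW,NW,SW]], P 5 4 [S,W,NW,SW,NW], P 5 4 [S,W,NW,NW,SW]], P 3 5 [W,SW,SE,S,E], X, P 3 5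
     [W,SW,SE,S,NE], X, X]]], P 3 5 [SW,S,SE], X, X, B 2 5 [X, P 5 4 [W,W,NW], P 5 4 [SW,NW,NW], P
     5 4 [NW,SW,NW], X, B 1 4 [P 3 5 [S,SW,NW], P 3 3 [W,NW,NE,E,SE], P 3 5 [W,SW,SE,E,E], P 3 3
     [W,NW,NE,E,E], X, X, X, P 3 5 [W,SW,SE,E,S]], X, B 1 4 [P 3 5 [S,SW,NW], P 3 2
     [NW,NW,NE,E,SE], P 3 5 [W,SW,SE,SE,NE], P 3 2 [NW,NW,NE,E,E], X, P 3 5 [W,SW,SE,SE,N], X,
     X]]], B 2 5 [X, P 5 4 [W,W,NW], P 5 4 [SW,NW,NW], P 5 4 [NW,SW,NW], X, B 3 6 [P 3 3
     [N,NW,NE], B 3 2 [P 2 5 [SE,S,S], B 5 3 [X, X, X, P 3 6 [SE,S,SE], B 5 5 [X, X, P 3 2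
     [NE,N,NE], X, B 4 6 [P 5 3 [N,N,NW], X, P 5 3 [W,N,NE,NW,W], X, X, P 2 4 [SE,NE,NE,NW,W], P 5
     5 [NW,W,SW,S,S,SE,N], X], P 3 2 [N,NE,NE], P 5 4 [N,SW,W,SW,SE], P 3 6 [S,SE,NE]], P 3 2
     [N,NE,SE], P 5 4 [S,NW,W,SW,SE], P 3 6 [S,SE,SE]], X, B 5 5 [X, X, P 3 4 [SE,NE,N], X, B 4 6
     [P 3 3 [NE,W,NW,NE,E], X, P 3 2 [NE,N,N,N,W], X, X, P 3 2 [N,NE,N,N,W], P 5 4
     [N,NW,S,SW,W,S,SE], X], P 5 4 [N,SW,W,NW,NE], P 5 4 [N,W,SW,SW,SE], P 3 6 [S,SE,NE]], P 2 5
     [S,SE,S], X, X, P 3 6 [SW,E,SE,SW,S]], B 2 6 [P 3 3 [N,NW,N], B 3 2 [P 2 5 [SE,S,S], B 4 2 [P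
     2 5 [SE,S,SE], X, X, P 2 6 [E,SE,S,S,S], P 2 5 [S,SE,SE], X, B 5 3 [X, X, X, P 3 4 [NE,SE,S],
     B 1 5 [P 3 3 [N,NW,W], X, P 5 4 [S,W,NW,W,NW], P 4 3 [N,N,NW,W,SW], X, X, P 2 5
     [W,SE,SE,SE,NE], P 4 4 [NW,NW,SW]], P 2 3 [E,SE,NE], X, P 2 6 [SE,SE,SE]], P 2 6
     [S,E,SE,SW,SE]], X, P 2 6 [E,SE,S,S,SW], P 2 5 [S,SE,S], X, X, P 2 6 [S,E,SE,SW,S]], X, B 1 5
     [P 3 3 [N,NW,W], P 2 6 [SW,E,NE,SE,S,SW,E], P 4 5 [NW,W,SW], X, X, X, B 1 6 [P 3 3 [N,NW,NW],
     P 2 6 [W,SE,NE,SE,S,SW,E], P 4 5 [NW,W,W], X, P 2 3 [N,NW,N], X, X, P 4 5 [W,NW,W]], P 4 5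
     [W,NW,SW]], P 3 3 [NW,N,N], X, B 1 4 [P 3 3 [N,NW,SW], P 2 6 [S,SW,SE,E,NE], P 3 3
     [W,NW,NE,N,E], B 5 5 [X, X, P 3 4 [SE,NE,N], X, P 5 4 [N,W,SW,W,W], P 5 4 [N,W,SW,NW,SW], P 5
     4 [N,W,SW,SW,NW], B 4 6 [P 5 5 [NW,SW,S], P 3 5 [NE,SE,SW], X, X, P 5 5 [NW,SW,SW], P 5 5
     [NW,SW,W], P 5 5 [NW,SW,NW], X]], X, X, X, P 3 3 [W,NW,NE,N,SE]], X], X, P 3 3 [NW,N,NE], X,
     B 1 4 [P 3 3 [N,NW,SW], P 3 6 [SW,SW,SE,E,NE], P 3 6 [SW,SW,SE,E,E], P 3 3 [W,NW,NE,NE,SE],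
     X, X, X, P 3 3 [W,NW,NE,NE,S]], X], B 5 5 [X, X, P 3 4 [SE,NE,N], X, B 1 4 [P 2 3 [NW,NE,SE],
     P 5 4 [N,SW,W,W,W], B 1 5 [P 2 3 [NE,NW,W], P 5 4 [N,SW,W,W,NW], X, P 5 4 [N,W,SW,W,NW], X, P
     2 5 [W,S,SE,E,E], X, B 2 6 [P 1 5 [NE,SE,S], P 1 5 [NE,SE,SE], P 2 3 [NW,NE,N], P 1 5
     [NE,SE,E], P 1 5 [NE,SE,SW], B 3 6 [P 2 3 [NE,NW,NE], B 4 6 [P 2 4 [E,E,NE,NW,W], X, P 5 5
     [NW,SW,SW,W,N], X, X, P 1 5 [NE,SE,NE], P 1 5 [E,E,NE], X], P 2 3 [NW,NE,NE], X, P 2 3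
     [N,N,NE], X, X, X], X, X]], P 5 4 [N,W,SW,W,W], X, P 2 5 [SW,SE,E], X, P 2 3 [NW,NE,E]], B 3
     2 [P 2 5 [SE,SW,SE], P 5 5 [SW,SW,S], X, P 5 4 [N,W,SW,S,S], P 2 5 [S,S,SE], X, X, B 4 2 [P 2
     5 [E,S,SW,SE,E], P 5 5 [SW,SW,SE], X, P 5 4 [N,W,SW,S,SE], P 2 5 [E,SW,S,SE,E], X, B 5 3 [X,
     X, X, P 3 4 [NE,SE,S], P 5 5 [S,S,SW,NW,N,W,S], P 2 3 [E,SE,NE], X, P 2 3 [SE,E,NE]], X]], B
     1 4 [P 2 3 [NW,NE,SE], P 5 4 [N,SW,W,SW,NW], B 3 2 [P 2 5 [SE,SW,SE], P 5 4 [N,SW,W,SW,SE],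
     X, P 5 4 [N,W,SW,SW,SE], P 2 5 [S,S,SE], X, X, B 1 5 [P 2 3 [NE,NW,W], P 5 4 [N,SW,W,NW,W],
     X, P 5 4 [N,W,SW,NW,W], X, P 2 5 [W,S,SE,E,E], X, P 2 5 [W,S,SE,SE,NE]]], P 5 4
     [N,W,SW,SW,NW], X, P 2 5 [SW,SE,E], X, P 2 3 [NW,NE,E]], B 4 6 [P 5 5 [NW,SW,S], P 3 5
     [NE,SE,SW], B 3 6 [P 2 3 [NE,NW,NE], P 5 5 [SW,NW,N], X, X, P 2 3 [N,N,NE], B 2 6 [P 2 3
     [NE,NW,N], P 5 5 [SW,NW,NW], P 5 5 [NW,SW,NW], P 5 5 [W,W,NW], P 2 3 [N,N,N], X, X, X], X,
     X], X, P 5 5 [NW,SW,SW], B 3 6 [P 2 3 [NE,NW,NE], P 5 5 [SW,NW,N], B 2 6 [P 2 3 [NE,NW,N], P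
     5 5 [SW,NW,NW], X, P 5 5 [W,W,NW], P 2 3 [N,N,N], P 5 5 [NW,SW,NW], X, X], X, P 2 3 [N,N,NE],
     X, X, X], P 5 5 [NW,SW,W], X]], X]]]]]]]], H]]"

lemma king_forbidden_4: "forbidden True 8 [((3, 4), (5, 4))]"
proof (rule forbidden_by_cert[OF king_separated_2])
  show "list_all (forbidden True 8) []"
    by (simp)
  show "refutes True 8 2 [] [((3, 4), (5, 4))] king_cert_4 [] 0"
    by code_simp
qed

lemma king_separated_4: "separated True 8 4"
  by (rule separated_extend[OF king_separated_2 king_forbidden_4]) (simp_all add: doubleton_eq_iff)

text \<open>With radius 4 available, (4, 4), (3, 4), (4, 3) and (4, 5) all need fresh colours, so
  five of the eight colours are in use before the tree really branches.\<close>

definition king_cert_5 :: cert where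
  "king_cert_5 =
    B 3 3 [B 5 4 [B 4 4 [X, B 3 4 [X, X, B 4 3 [X, X, X, B 4 5 [X, X, X, X, B 5 5 [X, X, B 2 4 [X,
     X, X, P 5 4 [SW,W,NW], P 5 5 [W,SW,W], B 2 3 [X, P 5 4 [W,SW,W], X, X, P 5 5 [W,SW,SW], X, B
     2 2 [X, P 5 4 [W,SW,SW], B 3 5 [X, X, X, B 2 5 [P 2 2 [NE,N,NW], P 5 5 [SW,W,NW], X, X, X, X,
     X, B 3 2 [X, P 5 4 [W,SW,S], X, X, P 5 5 [S,NW,SW,S,S], P 3 5 [SW,E,SE,SW,W], X, P 3 5
     [W,SE,SE,SW,W]]], X, X, P 2 2 [N,NE,N], B 2 5 [P 2 2 [NE,N,NW], P 5 5 [SW,W,NW], X, B 3 2 [X,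
     P 5 4 [W,SW,S], X, X, P 5 5 [S,NW,SW,S,S], P 2 5 [S,E,SE,SW,W], X, P 2 5 [E,S,SE,SW,W]], X,
     X, X, X]], P 5 4 [SW,W,SW], P 5 5 [S,NW,SW,S,SW], X, X, B 3 2 [X, P 5 4 [W,SW,S], X, X, P 5 5
     [S,NW,SW,S,S], B 4 2 [X, X, B 5 3 [X, X, X, X, P 3 3 [SE,NE,N,N,W], P 5 5 [S,S,SW,NW,NW], P 2
     4 [E,SW,SE,E,NE], P 5 5 [S,S,SW,NW,SW]], X, P 5 5 [S,NW,SW,S,SE], X, P 2 4 [S,SE,E], X], X,
     X]]]], P 3 3 [E,NE,N], X, B 6 5 [X, P 3 3 [NE,E,NE], B 6 4 [X, X, X, P 3 3 [E,NE,E], P 3 3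
     [N,NE,SE,NE,S], X, B 6 6 [B 7 5 [X, P 3 3 [N,E,E,NE,E], X, P 3 3 [N,SE,NE,NE,E], P 3 3
     [N,NE,SE,NE,E], X, X, B 7 4 [X, P 3 3 [N,E,E,NE,SE], X, P 3 3 [N,SE,NE,NE,SE], P 3 3
     [N,NE,SE,NE,SE], B 5 6 [X, P 3 3 [N,E,E,NE,NW], X, P 3 3 [N,SE,NE,NE,NW], X, X, P 7 4
     [W,NW,N], B 6 3 [X, P 3 3 [NE,E,SE], X, X, B 5 3 [X, X, P 6 6 [S,SW,S], X, X, X, X, P 6 3
     [W,N,NW,NE,E]], X, X, P 7 4 [SW,NW,N,N,E]]], X, X]], P 3 3 [N,E,E,NE,N], X, P 3 3
     [N,SE,NE,NE,N], P 3 3 [N,NE,SE,NE,N], X, X, B 5 6 [X, P 3 3 [N,E,E,NE,NW], X, P 3 3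
     [N,SE,NE,NE,NW], X, X, B 7 4 [X, P 3 3 [N,E,E,NE,SE], X, P 3 3 [N,SE,NE,NE,SE], P 3 3
     [N,NE,SE,NE,SE], P 5 6 [S,SE,E], X, B 6 3 [X, P 3 3 [NE,E,SE], X, X, B 3 5 [X, X, X, B 4 6 [P
     6 3 [NW,NW,N], X, P 4 3 [NW,N,NE], X, X, X, X, X], X, X, P 6 3 [N,N,SW,NW,W,S,S], P 6 4
     [S,NE,NW,NW,SW,W,S]], P 5 6 [S,SE,S], X, X]], X]]], P 3 3 [E,NE,NE], X, X, B 6 4 [X, X, B 6 3
     [X, P 3 3 [NE,E,SE], X, X, P 3 3 [N,NE,SE,E,S], B 7 4 [X, P 3 3 [N,E,E,E,E], X, P 3 3
     [N,SE,NE,E,E], P 3 3 [N,NE,SE,E,E], X, X, B 7 3 [P 5 5 [S,SE,E], P 3 3 [N,E,E,E,SE], X, P 3 3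
     [N,SE,NE,E,SE], P 3 3 [N,NE,SE,E,SE], X, B 5 3 [X, X, X, X, P 3 3 [N,NE,SE,E,SW], X, X, B 4 2
     [X, X, P 7 4 [W,SW,SW], X, P 6 4 [W,NW,SW,S,SE], P 7 4 [SW,W,SW], P 7 4 [NW,SW,S,SW,NW], X]],
     X]], X, B 5 3 [X, X, X, X, P 3 3 [N,NE,SE,E,SW], X, B 4 2 [X, X, P 6 5 [S,SW,SW], X, P 6 4
     [W,NW,SW,S,SE], P 6 5 [W,S,S,SW,NW], X, B 3 2 [X, P 5 4 [W,SW,S], X, X, P 6 4 [W,NW,SW,S,S],
     B 2 3 [X, P 5 4 [W,SW,W], X, X, P 6 4 [W,NW,SW,S,W], X, P 6 3 [NW,S,SW,NW,W], B 2 4 [X, X, X,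
     P 5 4 [SW,W,NW], P 6 4 [W,NW,SW,S,NW], P 4 2 [W,NW,N], P 6 3 [NW,S,SW,NW,NW], X]], P 6 3
     [W,SW,W], X]], X]], P 3 3 [E,NE,E], B 6 3 [X, P 3 3 [NE,E,SE], P 6 4 [S,NW,NW,SW,S], X, X, P
     4 5 [E,SE,S], X, B 5 3 [X, X, P 6 4 [SW,N,NW,SW,S], X, X, X, B 7 4 [X, P 6 5 [SE,W,SW,NW,N],
     B 7 5 [P 4 5 [SE,E,NE], P 6 5 [E,SW,SW,NW,N], X, P 4 5 [SW,SE,E,NE,E,N,W], X, X, X, B 4 2 [X,
     X, P 7 5 [W,SE,SW,W,SW], X, P 6 5 [S,SW,SW], P 6 5 [W,S,S,SW,NW], X, B 3 2 [X, P 5 4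
     [W,SW,S], X, X, P 6 5 [E,SW,SW,SW,W], B 2 3 [X, P 5 4 [W,SW,W], X, X, B 2 2 [X, P 5 4
     [W,SW,SW], P 4 5 [SW,SW,S], P 5 4 [SW,W,SW], X, X, P 6 3 [NW,S,SW,NW,SW], X], X, P 6 3
     [NW,S,SW,NW,W], P 6 4 [E,SW,NW,NW,SW,SW,E]], P 6 3 [W,SW,W], X]]], B 7 3 [P 4 5 [SE,E,SE], P
     6 5 [SE,S,NW,SW,W,N,N], P 6 5 [SE,S,NW,SW,W,NW,NE], X, X, P 4 5 [E,SE,SE], X, X], X, P 4 5
     [E,SE,E], X, X], X]], X, X, B 5 3 [X, X, B 4 2 [X, X, X, X, P 3 4 [S,SE,NE,N,NW], P 3 4
     [S,SE,NE,N,N], P 3 4 [S,SE,NE,N,NE], P 3 4 [S,SE,NE,N,E]], X, B 6 3 [X, P 4 5 [S,SE,E], P 3 3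
     [N,NE,SE,SE,W], X, X, B 4 6 [P 5 3 [N,NW,N], X, B 5 6 [X, P 5 3 [NW,N,NE], X, P 4 6
     [E,SW,SW,SE,E], X, X, X, P 6 3 [N,NW,N]], B 5 6 [X, P 5 3 [NW,N,NE], P 5 3 [W,NW,NE,N,E], X,
     X, X, X, P 6 3 [N,NW,N]], X, X, B 3 5 [X, X, X, B 3 6 [P 5 3 [N,NW,NW], P 4 3 [N,NW,N], X, X,
     X, P 6 5 [W,NW,W], X, P 6 3 [W,NE,NW,W,NW]], X, X, X, P 6 3 [W,NE,NW,W,W]], P 6 3 [N,NW,NW]],
     X, X], X, B 4 2 [X, X, B 5 2 [X, B 3 5 [X, X, X, P 4 2 [N,NW,N], X, X, P 5 2 [N,NW,NW], B 6 3
     [X, X, P 3 3 [N,E,E,SE,SW], X, B 6 2 [P 6 5 [SW,S,SE], X, X, P 4 4 [S,SE,E], X, P 3 5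
     [E,E,SE,S,S], X, X], P 6 5 [W,SW,SE,E,SW], X, X]], X, X, B 6 3 [X, P 3 3 [NE,E,SE], P 3 3
     [N,NE,SE,SE,SW], X, X, B 7 4 [X, P 5 3 [E,NE,NW,W,SW], P 5 5 [E,SE,SW,W,SW], P 5 5
     [E,SE,SW,W,W], P 5 3 [E,NE,NW,W,W], X, X, X], X, X], B 5 1 [P 3 4 [S,SE,SE], P 6 5
     [W,SW,SE,S,S], X, P 3 4 [SE,S,SE], B 4 1 [P 3 4 [S,SE,S], P 6 5 [W,SW,SE,S,SW], X, X, X, X, B
     3 2 [X, P 5 4 [W,SW,S], X, X, P 4 2 [W,N,N,NE,SE], X, X, B 6 3 [X, P 3 3 [NE,E,SE], P 4 1
     [N,NE,E], X, P 3 2 [SE,NE,NE,N,N,W,W], X, X, X]], P 6 5 [W,SE,SW,S,SW]], X, X, P 6 5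
     [W,SE,SW,S,S]], X, P 6 5 [S,SW,S]], X, B 5 2 [X, P 5 4 [NW,S,SW,SE,E], P 5 4 [NW,SW,S,SE,E],
     X, X, P 6 5 [W,W,SE,S,S,W,NW], X, P 6 5 [S,SW,S]], P 6 5 [W,S,S,SW,NW], X, P 6 5 [S,SW,SW]],
     X]]]]]]]], H]]"

lemma king_forbidden_5: "forbidden True 8 [((3, 3), (5, 4))]"
proof (rule forbidden_by_cert[OF king_separated_4])
  show "list_all (forbidden True 8) []"
    by (simp)
  show "refutes True 8 4 [] [((3, 3), (5, 4))] king_cert_5 [] 0"
    by code_simp
qed

lemma king_separated_5: "separated True 8 5"
  by (rule separated_extend[OF king_separated_4 king_forbidden_5]) (simp_all add: doubleton_eq_iff)

text \<open>Radius 5 alone forces seven of the eight colours, up to the vertex (3, 5); this is why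
  the tree is short although the pair has only one common neighbour.\<close>

definition king_cert_8 :: cert where
  "king_cert_8 =
    B 3 3 [B 5 5 [B 4 4 [X, B 3 4 [X, X, B 4 3 [X, X, X, B 4 5 [X, X, X, X, B 5 4 [X, X, X, X, X,
     B 3 5 [X, X, X, X, X, X, B 4 6 [X, X, X, B 2 4 [X, X, X, X, X, P 4 6 [SE,S,SW,W,NW], X, B 3 6
     [X, X, X, X, X, P 3 3 [E,NE,N,NW,W], X, X]], X, X, X, B 5 6 [X, X, B 2 4 [X, X, X, X, X, B 2
     5 [X, X, X, P 5 5 [S,SW,W,NW,N], X, X, X, X], X, B 2 3 [X, X, X, X, P 5 6 [SW,SW,SW], B 1 4
     [X, P 5 5 [S,W,SW,W,NW], X, P 5 5 [S,SW,W,W,NW], P 5 6 [W,S,SW,W,W], X, X, X], X, X]], B 2 4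
     [X, X, X, X, X, P 5 6 [S,S,SW,W,NW], X, B 2 3 [X, X, X, X, B 3 2 [X, X, X, X, X, P 5 6
     [S,S,SW,W,S], P 4 6 [S,W,SW,S,SE], X], P 5 6 [S,S,SW,W,W], X, X]], X, X, X, X]]]]]]]], H]]"

lemma king_forbidden_8: "forbidden True 8 [((3, 3), (5, 5))]"
proof (rule forbidden_by_cert[OF king_separated_5])
  show "list_all (forbidden True 8) []"
    by (simp)
  show "refutes True 8 5 [] [((3, 3), (5, 5))] king_cert_8 [] 0"
    by code_simp
qed

lemma king_separated_8: "separated True 8 8"
  by (rule separated_extend[OF king_separated_5 king_forbidden_8]) (simp_all add: doubleton_eq_iff)

definition king_cert :: cert where
  "king_cert =
    B 2 2 [B 1 2 [X, B 2 1 [X, X, B 2 3 [X, X, X, B 3 2 [X, X, X, X, B 1 1 [X, X, X, X, X, B 1 3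
     [X, X, X, X, X, X, B 3 1 [X, X, X, X, X, X, X, B 3 3 [X, X, X, X, X, X, X, X]]]]]]]]]"

lemma king_forbidden: "forbidden True 8 []"
proof (rule forbidden_by_cert[OF king_separated_8])
  show "list_all (forbidden True 8) []"
    by (simp)
  show "refutes True 8 8 [] [] king_cert [] 0"
    by code_simp
qed


subsection \<open>The Cartesian grid\<close>

lemma rook_separated_1: "separated False 5 1"
  using separated_adjacent[of False 5] by simp

text \<open>Each of \<open>rook_a\<close>, \<open>rook_b\<close>, \<open>rook_c\<close> contains an
  equally coloured pair at squared distance 2 and thus is a special case of what is to be excluded.
  The additional equation is what the separate trees start from, and the results then serve as
  \<open>Q\<close> leaves. Here a diagonal pair shares its colour with a vertex a knight's move from
  both.\<close>

definition rook_a :: equations where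
  "rook_a = [((5, 5), (6, 7)), ((5, 5), (7, 6))]"

text \<open>The vertex (5, 5) is a common neighbour of the diagonal pair (5, 6), (6, 5), so two
  different colours are involved.\<close>

definition rook_b :: equations where
  "rook_b = [((5, 5), (7, 8)), ((5, 6), (6, 5))]"

text \<open>Three of the four neighbours of (6, 6) have the same colour.\<close>

definition rook_c :: equations where
  "rook_c = [((6, 5), (6, 7)), ((6, 5), (7, 6))]"

definition rook_cert_a :: cert where
  "rook_cert_a =
    B 5 5 [B 6 7 [B 7 6 [B 6 6 [X, B 5 6 [X, X, B 5 7 [X, P 7 6 [W,N,W], X, B 7 7 [X, P 6 7
     [E,S,W], B 6 8 [X, P 7 6 [W,N,N], P 7 6 [N,W,N], B 7 8 [P 5 7 [E,N,E], P 5 5 [N,E,N,E,N], X,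
     X, B 5 8 [P 5 7 [N,E,S], B 6 5 [X, X, B 7 5 [X, P 5 6 [E,S,E], X, B 4 6 [P 6 5 [W,N,W], P 6 5
     [N,W,W], X, B 4 5 [X, P 7 7 [W,S,W,S,W], P 5 7 [S,W,S], X, B 4 7 [P 4 6 [N,E,E], P 4 6
     [N,E,N], P 4 6 [N,E,S], X, P 5 7 [W,S,S]]], B 4 5 [X, P 7 7 [W,S,W,S,W], B 4 7 [P 6 8
     [S,W,W], P 6 8 [W,S,W], B 3 7 [B 3 6 [X, B 3 5 [P 5 6 [S,W,W], X, X, P 5 5 [W,W,N,N,E,E,N], P
     4 7 [S,S,W]], P 7 5 [W,W,N,N,W,W,S], P 7 7 [W,W,W,W,S], X], P 7 6 [S,W,N,N,W,W,W], X, P 5 6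
     [N,W,W], P 4 5 [N,N,W]], X, X], P 7 7 [W,W,S,S,W], X]], P 5 5 [E,E,N,N,N]], P 7 7
     [W,W,S,S,E], B 7 5 [X, P 6 7 [S,E,S], P 6 7 [E,S,S], B 6 4 [B 5 4 [X, P 7 7 [W,S,W,S,S], P 6
     4 [W,N,N], P 7 7 [W,W,S,S,S], P 5 5 [S,E,N]], B 7 4 [P 7 8 [W,S,S,S,E,S,W], X, P 6 7
     [W,S,E,E,S,S,W], X, P 6 6 [S,S,E]], P 6 7 [N,E,S,S,S,W,S], B 5 4 [X, P 7 7 [W,S,W,S,S], B 7 4
     [P 6 4 [E,N,N], B 7 9 [P 5 4 [E,E,N,W,W,N,N,N,E,E,N], P 7 6 [S,W,N,N,N,E,N], B 6 9 [P 5 7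
     [E,N,N], P 5 7 [N,E,N], X, X, P 7 7 [N,N,W]], B 6 9 [P 5 7 [E,N,N], P 5 7 [N,E,N], B 8 8 [P 5
     4 [E,E,N,W,W,N,N,N,E,E,E], P 7 6 [S,W,N,N,N,E,E], B 8 7 [P 8 8 [S,W,W], P 5 5 [N,E,N,E,E], X,
     P 5 5 [N,N,E,E,E], P 7 7 [E,N,W]], B 8 9 [P 8 8 [N,W,W,S,S,W,S], P 8 8 [N,W,W,S,W,S,S], P 6 8
     [N,E,E], X, P 6 8 [E,N,E]], X], X, P 6 8 [N,E,S]], X], P 7 5 [S,W,W], X, P 6 4 [E,N,W]], X, P
     7 5 [W,S,W]], X], X]], P 6 8 [W,S,S], X, P 5 7 [N,E,E]]], B 7 8 [B 8 7 [B 8 6 [X, P 6 7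
     [S,E,E], P 6 7 [E,S,E], B 8 8 [X, P 5 7 [E,S,E,E,N,N,W], P 6 7 [E,N,E], P 7 8 [E,S,S], P 6 7
     [N,E,E]], B 8 8 [X, P 6 7 [N,E,E,S,S,W,W], P 6 7 [E,N,E], P 7 6 [E,N,N,W,W,S,W], P 6 7
     [N,E,E]]], P 5 5 [N,E,N,E,E], X, P 5 5 [N,N,E,E,E], B 8 6 [X, P 6 7 [S,E,E], P 6 7 [E,S,E], B
     6 5 [X, X, B 7 5 [X, P 5 6 [E,S,E], X, B 8 5 [P 7 5 [E,N,W], B 6 4 [P 5 6 [S,E,S], P 5 6
     [E,S,S], X, B 5 4 [X, P 7 7 [W,S,W,S,S], P 7 5 [W,S,W], X, B 7 4 [P 6 4 [E,N,N], P 6 4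
     [E,N,E], P 6 4 [E,N,W], X, P 7 5 [S,W,W]]], B 5 4 [X, P 7 7 [W,S,W,S,S], B 7 4 [P 8 6
     [W,S,S], P 8 6 [S,W,S], B 7 3 [B 6 3 [X, B 5 3 [P 5 6 [S,S,S], X, X, P 8 5 [W,S,S,W,W,N,N], P
     6 5 [S,W,S]], P 5 7 [S,S,E,E,S,S,W], P 7 7 [S,S,S,S,W], X], P 6 7 [W,S,E,E,S,S,S], X, P 6 5
     [E,S,S], P 5 4 [E,E,S]], X, X], P 7 7 [W,W,S,S,S], X]], P 8 6 [S,W,W], X, P 7 5 [E,N,N]], P 5
     5 [E,E,N,N,E]], P 7 7 [W,W,S,S,E], B 7 5 [X, P 6 7 [S,E,S], P 6 7 [E,S,S], B 8 8 [X, P 7 5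
     [W,N,E,E,N,N,W], P 6 7 [E,N,E], B 6 4 [B 5 4 [X, P 7 7 [W,S,W,S,S], P 6 4 [W,N,N], P 7 7
     [W,W,S,S,S], P 5 5 [S,E,N]], B 7 4 [P 8 6 [W,S,S], X, P 6 7 [W,S,E,E,S,S,W], X, P 6 6
     [S,S,E]], P 7 8 [E,S,W,S,S,W,S], P 7 8 [E,S,S,W,S,W,S], X], X], X]], X]], P 5 5 [N,E,N,E,N],
     X, P 5 5 [N,N,E,E,N], X]], P 7 6 [N,W,W], B 6 5 [X, X, B 7 5 [X, P 5 6 [E,S,E], X, B 8 6 [X,
     P 6 7 [S,E,E], B 8 7 [B 6 8 [X, P 7 6 [W,N,N], B 7 8 [B 8 8 [X, P 6 7 [N,E,E,S,S,W,W], P 6 7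
     [N,E,E], P 7 6 [E,N,N,W,W,S,W], P 6 7 [E,N,E]], P 5 5 [N,E,N,N,E], X, P 5 5 [N,N,E,N,E], X],
     B 7 8 [P 5 7 [E,N,E], B 5 8 [P 5 7 [N,E,S], P 5 7 [N,E,E], P 6 8 [W,S,S], X, B 8 8 [X, X, P 7
     6 [E,N,N], B 4 7 [P 6 8 [S,W,W], B 4 6 [P 6 5 [W,N,W], X, X, P 8 7 [N,W,W,S,W,W,S], P 8 7
     [N,W,S,W,W,W,S]], B 4 6 [P 4 7 [S,E,S], P 4 7 [S,E,E], X, P 4 7 [S,E,N], B 4 5 [X, P 8 6
     [W,W,W,S,W], B 3 7 [B 4 8 [B 3 8 [X, B 3 6 [X, P 4 8 [W,S,S], P 4 8 [S,W,S], P 8 6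
     [W,W,N,W,W,N,W,S,S], X], P 3 7 [N,E,S], P 7 7 [W,W,N,W,W], P 3 7 [N,E,E]], P 7 6
     [S,W,N,N,W,W,N], X, P 5 6 [N,W,N], X], P 7 6 [S,W,N,N,W,W,W], X, P 5 6 [N,W,W], P 4 5
     [N,N,W]], P 8 6 [W,S,W,W,W], X]], X, P 6 8 [W,S,W]], P 6 7 [E,E,N]]], B 8 8 [X, P 7 6
     [S,W,N,N,N,E,E], X, B 4 6 [P 6 5 [W,N,W], P 6 5 [N,W,W], X, P 8 7 [N,W,W,S,W,S,W], P 8 7
     [N,W,S,W,W,S,W]], P 6 7 [E,E,N]], X, X], P 7 6 [N,W,N]], P 5 5 [N,E,E,E,N], X, P 5 5
     [E,E,N,E,N], X], B 8 7 [P 7 5 [N,E,N], B 8 5 [P 7 5 [E,N,W], P 7 5 [E,N,N], P 8 6 [S,W,W], X,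
     B 7 4 [P 8 6 [W,S,S], B 6 8 [X, P 7 6 [W,N,N], B 7 8 [B 8 8 [X, X, P 6 7 [N,E,E], B 6 4 [P 5
     6 [S,E,S], X, X, P 7 8 [E,S,S,W,S,S,W], P 7 8 [E,S,W,S,S,S,W]], P 6 7 [E,N,E]], P 5 5
     [N,E,N,N,E], X, P 5 5 [N,N,E,N,E], X], B 6 4 [P 5 6 [S,E,S], X, X, B 5 4 [X, P 7 5 [S,W,W], P
     7 5 [W,S,W], X, B 9 6 [P 7 5 [N,E,E], B 9 7 [B 9 5 [P 8 7 [E,S,S], X, B 8 4 [P 8 7
     [S,S,S,W,W,W,N], X, P 5 4 [E,E,E,N,N,E,S], B 9 4 [B 6 3 [B 7 3 [X, X, P 7 6 [E,E,S,S,W,W,S],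
     P 8 7 [S,W,S,S,W,S,E], P 8 6 [N,W,S,S,S,S,W]], P 7 5 [S,W,S], P 7 5 [W,S,S], X, B 7 3 [B 8 3
     [X, P 6 4 [E,E,S], P 8 5 [S,S,W,W,N,N,W], X, P 7 5 [E,S,S]], X, P 7 6 [E,E,S,S,W,W,S], P 5 4
     [E,S,E], X]], P 6 4 [E,E,E], X, X, P 7 5 [E,S,E]], X], P 8 7 [S,E,S], X], X, B 8 4 [P 8 7
     [S,S,S,W,W,W,N], X, P 5 4 [E,E,E,N,N,N,E], B 9 5 [B 9 4 [X, P 6 4 [E,E,E], P 6 4
     [W,N,E,E,E,E,S], X, P 7 5 [E,S,E]], X, P 8 7 [E,S,S], P 8 7 [S,E,S], X], X], P 8 7 [E,S,W], P
     9 6 [N,W,W]], B 9 5 [P 8 6 [E,S,W,W,W,W,S], P 6 7 [W,S,E,E,E,E,S], X, P 8 6 [E,S,W,W,W,S,W],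
     X], X, P 7 5 [E,N,E]]], B 7 8 [P 5 7 [E,N,E], P 6 4 [E,N,N,N,N,W,S], P 6 4 [N,E,N,N,N,W,S],
     X, X]], P 7 6 [N,W,N]], B 6 4 [P 5 6 [S,E,S], P 5 6 [E,S,S], X, P 6 5 [S,E,N], B 7 3 [B 8 4
     [B 8 3 [X, B 6 3 [X, P 8 4 [S,W,W], P 8 4 [W,S,W], P 7 7 [W,S,E,S,E,S,S,W,W], X], P 7 3
     [E,N,W], P 7 7 [S,S,E,S,S], P 7 3 [E,N,N]], P 6 7 [W,S,E,E,S,S,E], X, P 6 5 [E,S,E], X], P 6
     7 [W,S,E,E,S,S,S], X, P 6 5 [E,S,S], P 6 5 [S,E,S]]], X, P 8 6 [S,W,S]]], B 4 6 [P 6 5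
     [W,N,W], P 6 5 [N,W,W], X, B 6 8 [X, P 7 6 [W,N,N], B 7 8 [B 8 8 [X, P 6 7 [W,S,E,E,E,N,N],
     X, B 6 4 [P 5 6 [S,E,S], P 5 6 [E,S,S], X, P 7 8 [E,S,S,W,S,W,S], P 7 8 [E,S,W,S,S,W,S]], P 6
     7 [E,N,E]], P 5 5 [N,E,N,N,E], X, P 5 5 [N,N,E,N,E], X], B 7 8 [P 5 7 [E,N,E], B 5 8 [P 5 7
     [N,E,S], P 5 7 [N,E,E], P 4 6 [E,N,N], X, B 4 7 [P 4 6 [N,E,E], B 4 5 [X, P 5 7 [W,S,S], P 5
     7 [S,W,S], X, B 6 9 [P 5 7 [E,N,N], B 7 9 [B 8 8 [P 6 9 [E,S,E], X, X, P 6 9 [S,E,E], B 8 9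
     [X, P 7 7 [N,E,N], P 7 7 [E,N,N], P 6 6 [N,N,N,E,E], X]], X, B 4 8 [P 6 9 [S,W,W,S,S,S,E], X,
     P 4 5 [N,N,N,E,E,N,E], B 5 9 [B 4 9 [X, P 4 6 [N,N,N], P 4 6 [S,E,N,N,N,N,W], X, P 5 7
     [N,W,N]], X, P 7 8 [N,W,W], P 7 8 [W,N,W], X], X], P 6 9 [E,S,W], P 6 9 [E,S,S]], B 5 9 [P 6
     8 [N,W,S,S,S,S,W], P 7 6 [S,W,N,N,N,N,W], X, P 6 8 [N,W,S,S,S,W,S], X], X, P 5 7 [N,E,N]]], P
     4 6 [N,E,S], X, P 4 6 [N,E,N]]], B 8 8 [P 5 6 [N,E,N,E,E,S,S,W,S,W,W], P 7 6 [S,W,N,N,N,E,E],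
     X, P 8 7 [N,W,W], P 7 8 [E,S,W]], X, X], P 7 6 [N,W,N]], P 7 6 [E,N,W,W,W,S,W]], X, X], P 6 7
     [E,S,E]], P 6 7 [E,S,S]], B 7 5 [X, P 6 7 [S,E,S], P 6 7 [W,S,S,E,E], X, P 6 7 [E,S,S]], B 7
     5 [X, P 6 7 [S,E,S], P 7 7 [S,S,W,W,N], B 8 6 [X, P 6 7 [S,E,E], B 8 7 [B 6 8 [X, P 7 6
     [W,N,N], B 7 8 [B 8 8 [X, P 6 7 [N,E,E,S,S,W,W], P 6 7 [N,E,E], P 7 6 [E,N,N,W,W,S,W], P 6 7
     [E,N,E]], P 5 5 [N,E,N,N,E], X, P 5 5 [N,N,E,N,E], X], B 7 8 [P 5 7 [E,N,E], P 5 5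
     [E,N,N,E,N], B 8 8 [X, P 8 7 [N,W,W,S,S,W,N], X, B 4 6 [B 4 5 [X, P 8 6 [W,W,W,W,S], P 4 6
     [S,E,N], P 7 7 [S,S,W,W,W], P 4 6 [S,E,E]], B 4 7 [P 6 8 [S,W,W], X, P 6 6 [W,W,N], X, P 7 6
     [S,W,N,N,W,W,S]], X, P 8 7 [N,W,W,S,W,S,W], P 8 7 [N,W,S,W,W,S,W]], P 6 7 [E,E,N]], X, X], P
     7 6 [N,W,N]], P 5 5 [E,N,N,E,E], X, P 5 5 [E,E,N,N,E], X], B 8 7 [P 7 5 [N,E,N], P 5 5
     [E,N,N,E,E], B 8 5 [P 7 5 [E,N,W], B 4 6 [B 4 5 [X, P 7 7 [W,S,S,W,W], P 4 6 [S,E,N], P 7 7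
     [S,S,W,W,W], P 4 6 [S,E,E]], B 4 7 [P 8 7 [S,W,W,W,N,W,S], X, P 6 6 [W,W,N], X, P 7 6
     [S,W,N,N,W,W,S]], X, B 4 5 [X, P 7 7 [W,S,S,W,W], P 5 7 [S,W,S], X, B 4 7 [P 4 6 [N,E,E], B 9
     6 [P 7 5 [N,E,E], P 7 5 [E,N,E], B 9 7 [P 4 5 [N,N,E,S,S,E,E,E,N,N,E], P 6 7 [W,S,E,E,E,N,E],
     X, P 8 7 [E,S,W], P 9 6 [N,W,W]], X, B 9 7 [P 4 5 [N,N,E,S,S,E,E,E,N,N,E], P 6 7
     [W,S,E,E,E,N,E], X, B 8 8 [P 4 5 [N,N,E,S,S,E,E,E,N,N,N], P 6 7 [W,S,E,E,E,N,N], X, B 9 8 [P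
     6 5 [E,N,E,E,N,N,W], P 6 5 [E,E,N,E,N,N,W], P 8 6 [N,N,E], X, P 8 8 [E,S,S]], B 7 8 [P 8 8
     [W,S,W], P 5 5 [E,N,N,E,N], P 7 7 [N,E,S], P 5 5 [E,E,N,N,N], X]], X]], P 4 6 [N,E,S], X, P 5
     7 [W,S,S]]], P 7 6 [E,N,W,W,W,S,W]], P 7 5 [E,N,N], X, P 8 6 [S,W,W]], X, X], P 6 7 [E,S,E]],
     X]]]]]], H], H]]"

lemma forbidden_rook_a: "forbidden False 5 rook_a"
proof (rule forbidden_by_cert[OF rook_separated_1])
  show "list_all (forbidden False 5) []"
    by (simp)
  show "refutes False 5 1 [] rook_a rook_cert_a [] 0"
    by code_simp
qed

definition rook_cert_b :: cert where
  "rook_cert_b =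
    B 5 5 [B 7 8 [B 5 6 [X, B 6 5 [X, B 6 6 [P 5 6 [E,S,W], X, B 4 6 [P 6 5 [W,N,W], X, P 6 5
     [N,W,W], B 5 7 [P 6 5 [W,N,N], X, P 6 5 [N,W,N], B 7 7 [X, Q 0 3 12 12, B 6 7 [P 6 6 [N,E,N],
     P 4 6 [E,N,E], X, X, B 7 6 [P 6 6 [E,N,N], P 7 7 [S,W,W], X, B 7 5 [P 5 6 [S,E,E], X, P 5 6
     [E,S,E], X, B 4 7 [B 5 8 [P 4 6 [N,E,N], P 4 6 [E,N,N], Q 0 2 0 13, X, B 6 8 [X, B 4 8 [X, P
     6 7 [N,W,W], B 7 9 [X, P 7 6 [S,W,W,N,N,N,E,E,N], B 8 7 [P 7 9 [S,S,E], B 8 8 [X, X, B 8 9 [P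
     7 7 [N,N,E], P 7 9 [E,S,S], X, P 5 6 [E,E,N,E,N,N,W], P 5 6 [E,N,E,E,N,N,W]], P 5 8
     [W,S,E,E,E,N,E], B 8 6 [P 5 8 [E,E,E,S,S], X, B 8 5 [P 6 6 [S,E,E,N,N,N,W], P 7 7 [E,S,S], X,
     P 6 6 [E,E,S], X], X, Q 0 2 1 12]], X, P 6 6 [E,N,E], P 6 6 [N,E,E]], P 5 8 [W,S,E,E,E,N,N],
     Q 0 3 12 14], P 6 7 [W,N,W], X], P 5 8 [E,S,S], Q 0 1 12 1, X]], P 4 6 [N,E,S], P 7 5
     [N,W,N,W,W], X, P 4 6 [N,E,E]]], P 6 6 [E,N,W]]], B 6 7 [P 5 7 [E,E,N], P 4 6 [E,N,E], X, X,
     B 4 7 [B 5 8 [P 4 6 [N,E,N], P 4 6 [E,N,N], B 7 5 [P 5 6 [S,E,E], X, P 5 6 [E,S,E], B 7 6 [P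
     7 5 [N,N,N], P 7 7 [S,S,W], X, X, P 7 5 [N,N,W]], B 6 8 [X, P 7 5 [W,N,N,N,W], X, B 3 6 [Q 0
     1 10 0, P 5 7 [S,W,W], P 7 7 [N,W,W,S,W,S,W], X, P 7 7 [N,W,S,W,W,S,W]], X]], X, P 7 7
     [W,W,N]], P 4 6 [N,E,S], B 4 5 [X, P 5 7 [S,W,S], P 5 7 [W,S,S], X, B 7 6 [B 7 5 [X, X, P 5 6
     [E,S,E], P 7 8 [S,S,S], B 8 6 [X, P 4 5 [E,E,E,N,E], B 8 7 [P 6 6 [E,E,N], P 8 6
     [N,W,W,S,W,W,S], X, X, P 5 7 [E,E,E]], P 7 8 [S,S,E], Q 0 2 1 12]], B 7 5 [P 5 6 [S,E,E], X,
     P 5 6 [E,S,E], P 6 5 [E,N,N], B 6 4 [P 5 6 [S,E,S], X, P 5 6 [E,S,S], B 4 4 [B 3 6 [Q 0 2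
     (-2) 11, P 5 7 [S,W,W], P 5 7 [W,S,W], X, B 5 4 [X, P 4 4 [E,N,N], B 3 5 [P 3 6 [S,E,S], B 3
     7 [P 6 4 [W,W,N,N,N,W,S], P 4 5 [W,N,N], X, P 4 5 [N,W,N], X], P 7 6 [N,W,S,W,W,W,S], P 3 6
     [S,E,N], X], X, P 4 4 [E,N,W]]], Q 0 0 (-1) (-1), P 7 6 [N,W,S,W,W,S,S], P 7 6
     [N,W,W,S,W,S,S], X], P 7 6 [S,W,S]]], X, X, P 5 7 [E,E,S]]], X, P 4 6 [N,E,E]]], B 6 7 [B 6 8
     [X, B 4 5 [X, P 5 7 [S,W,S], P 6 8 [S,S,W,S,W], X, B 4 7 [P 4 6 [N,E,E], Q 0 3 11 13, B 7 6
     [Q 0 0 0 0, B 7 5 [P 5 6 [S,E,E], X, P 5 6 [E,S,E], B 6 4 [P 5 6 [S,E,S], X, P 5 6 [E,S,S], P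
     7 6 [S,W,S], B 8 6 [Q 0 1 13 1, X, P 5 6 [E,E,E], P 6 5 [E,N,E], B 5 4 [X, B 8 5 [P 8 6
     [S,W,N,N,W,W,S], P 7 7 [S,E,S], B 7 4 [P 5 6 [N,E,E,S,S,S,W], B 8 7 [P 8 6 [N,W,W], Q 0 2 1
     13, P 7 7 [E,S,S], B 8 4 [B 8 8 [X, P 6 7 [N,E,E], B 5 8 [B 4 8 [X, P 6 7 [N,W,W], X, P 6 7
     [W,N,W], B 5 9 [X, P 6 7 [N,W,N], B 4 9 [B 3 9 [X, P 7 8 [S,W,N,W,W,N,W], P 5 8 [N,W,W], P 7
     8 [S,W,W,N,W,N,W], P 5 8 [W,N,W]], P 5 9 [W,S,S,S,E,E,E,E,S,W,W], X, P 5 9 [W,S,S,S,S], X], P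
     6 7 [W,N,N], B 6 9 [P 4 8 [E,N,E], X, P 5 5 [N,E,N,N,N], P 5 5 [N,N,N,E,N], X]]], X, Q 0 1 11
     1, X, B 6 9 [B 4 8 [P 8 7 [W,W,W,N,W], P 8 5 [S,W,W,N,N,N,N,W,W], X, B 7 9 [X, P 6 7 [N,N,E],
     P 6 9 [E,S,E], B 5 9 [X, P 6 7 [N,N,W], B 4 9 [B 3 8 [P 8 8 [W,N,W,W,W,S,W], B 3 7 [P 7 6
     [N,E,N,W,W,W,W,S,W], X, X, P 4 5 [N,E,N,N,W,W,S], B 3 6 [P 4 5 [N,W,N,N,E,E,S,E,E,S,S], P 5 7
     [S,W,W], P 4 8 [S,S,W], X, X]], Q 0 3 10 14, X, P 5 7 [N,W,W]], P 7 9
     [W,W,W,S,E,S,E,S,W,W,S], X, X, P 5 7 [N,W,N]], P 7 8 [N,W,W], X], P 6 9 [E,S,S]], X], X, P 5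
     5 [N,E,N,N,N], P 5 5 [N,N,E,N,N], Q 0 1 12 2]], X, P 6 7 [E,N,E]], X, X, P 6 5 [E,S,E], P 5 4
     [E,E,E]], X], Q 0 2 1 11, X, X], X, X], P 6 8 [S,S,W,S,S], P 6 8 [S,W,S,S,S], X]]], P 6 5
     [E,N,N]], X, P 6 8 [S,E,S,W,W,S,W,N,N], X], X, P 5 7 [W,S,S]]], P 7 8 [W,S,S], P 7 8 [W,S,W],
     P 6 7 [N,E,S]], P 4 6 [E,N,E], X, X, X]], B 7 7 [X, Q 0 3 12 12, B 6 7 [P 6 6 [N,E,N], P 7 7
     [W,S,W], X, B 7 6 [P 6 6 [E,N,N], P 7 7 [S,W,W], X, P 6 6 [E,N,W], B 7 5 [P 5 6 [S,E,E], X, P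
     5 6 [E,S,E], B 8 6 [B 8 7 [X, B 8 5 [X, P 8 7 [S,S,W,W,W,N,W], Q 0 1 13 0, X, B 6 4 [P 5 6
     [S,E,S], X, P 5 6 [E,S,S], B 5 4 [X, P 7 5 [W,S,W], B 6 8 [X, P 5 4 [E,N,N,N,N], B 4 5 [X, B
     5 8 [P 7 7 [N,W,W], B 7 4 [B 4 4 [P 5 6 [S,W,S], X, X, P 5 6 [W,S,S], B 6 9 [P 7 7 [N,W,N], B
     5 9 [P 6 9 [W,S,S,S,S,W,S], X, P 5 8 [N,E,S], P 6 9 [W,S,S,S,W,S,S], P 5 6 [N,N,N]], X, P 6 6
     [N,N,N], B 7 9 [X, P 6 4 [W,N,N,N,E,N,E,N,W], B 7 10 [P 6 8 [E,N,N], B 8 9 [P 6 8 [E,N,E], B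
     8 8 [X, X, P 8 9 [S,S,W], P 5 8 [E,N,E,E,S,S,W,S,W,W,W], P 7 10 [S,W,S,W,S,S,E,E,N,E,N]], X,
     P 7 7 [S,W,N,N,N,E,E], P 6 8 [N,E,E]], X, P 7 7 [S,W,N,N,N,E,N], P 6 8 [N,E,N]], P 7 4
     [N,N,N,N,N,W,S], X]]], P 6 4 [E,N,W], P 7 5 [S,W,W], X, P 6 4 [E,N,N]], X, Q 0 0 (-1) 1, X],
     Q 0 3 11 11, X, P 7 7 [E,S,W,W,W,S,W]], X, Q 0 1 12 1], X, P 7 7 [E,S,W,W,W,S,S]], Q 0 0 1
     (-1)]], X, P 6 6 [N,E,E], P 6 6 [E,N,E]], B 6 8 [X, P 7 8 [W,S,W,S,S,E,E,N,E], B 8 7 [P 6 8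
     [E,S,E], X, X, P 6 6 [N,E,E], P 6 6 [E,N,E]], X, Q 0 1 12 1], B 8 7 [P 8 6 [N,W,N], B 8 5 [B
     9 6 [B 9 7 [X, X, P 8 5 [N,E,N], P 9 6 [N,W,S,S,W,W,N], B 8 8 [X, X, B 9 8 [P 7 7 [N,E,E], P
     7 7 [E,N,E], X, P 6 6 [W,N,E,E,E,E,N], X], P 6 6 [S,E,E,N,N,N,W], Q 0 0 2 1]], P 7 7 [E,S,E],
     X, B 9 5 [X, P 9 6 [S,W,W,W,W], P 5 6 [E,N,E,E,S,E,S], X, B 9 7 [P 7 6 [S,E,E,N,N], X, P 8 6
     [E,N,W,W,W,S,W], X, P 8 6 [E,N,W,W,W,W,S]]], P 6 6 [E,E,E]], P 7 7 [E,S,S], X, X, P 6 6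
     [E,E,S]], X, P 6 6 [N,E,E], P 6 6 [E,N,E]], Q 0 2 1 12, X], X]], X], B 6 7 [B 6 8 [X, B 4 5
     [X, B 7 6 [Q 0 0 0 0, B 7 5 [P 4 5 [E,E,E], X, P 5 6 [E,S,E], P 6 5 [E,N,N], B 6 4 [P 4 5
     [E,E,S], X, P 5 6 [E,S,S], B 5 4 [X, B 4 4 [P 4 5 [S,E,N], X, P 5 6 [W,S,S,E,E,N,N], P 5 6
     [W,S,S], P 6 5 [S,W,W,N,N,E,N]], P 6 8 [S,S,W,S,S], X, P 6 8 [S,W,S,S,S]], P 7 6 [S,W,S]]],
     X, X, B 7 5 [P 4 5 [E,E,E], X, P 5 6 [E,S,E], B 5 4 [X, B 6 4 [P 4 5 [E,S,E], X, P 5 4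
     [E,N,N], P 5 4 [E,N,E], B 4 4 [P 4 5 [S,E,N], X, P 5 7 [S,E,S,S,W,W,N], P 5 6 [W,S,S], P 4 5
     [S,E,E]]], P 6 8 [S,S,W,S,S], B 6 4 [P 4 5 [E,E,S], X, P 5 6 [E,S,S], X, B 7 4 [P 7 6
     [S,S,W,W,N], B 7 3 [P 5 6 [W,S,E,E,E,S,S], X, P 4 5 [N,E,E,S,E,S,S], P 6 5 [E,S,S], P 6 5
     [S,E,S]], P 5 4 [E,E,N,N,W], X, X]], P 6 8 [S,W,S,S,S]], X]], P 6 8 [S,S,W,S,W], X, P 6 8
     [S,W,S,S,W]], P 7 8 [W,S,S], P 6 7 [N,E,S], P 7 8 [W,S,W]], B 6 8 [X, X, P 5 6 [E,N,N], B 7 6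
     [P 6 8 [E,S,S], P 6 8 [S,E,S], X, X, B 7 5 [P 5 6 [S,E,E], X, P 5 6 [E,S,E], B 5 8 [P 7 7
     [N,W,W], P 7 7 [W,N,W], B 8 7 [P 6 8 [E,S,E], P 6 8 [S,E,E], B 6 9 [P 7 7 [N,W,N], P 7 7
     [W,N,N], B 5 9 [B 4 8 [P 6 9 [W,S,W], Q 0 2 (-1) 13, X, P 6 9 [S,W,W], B 4 7 [B 7 9 [X, B 8 8
     [X, Q 0 0 1 2, X, B 8 9 [P 6 8 [E,E,N], X, P 7 7 [E,N,N], X, B 6 4 [P 5 6 [S,E,S], X, P 5 6
     [E,S,S], B 7 4 [P 8 9 [S,W,S,S,S,S,W], P 6 4 [E,N,W], P 8 9 [S,S,W,S,S,S,W], X, P 6 4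
     [E,N,N]], B 5 4 [X, B 4 4 [P 5 6 [S,S,W], X, P 6 7 [W,S,E,S,S,W,W], B 4 5 [X, P 4 6 [S,S,E],
     P 7 5 [W,S,W,W,N,N,E,N,E,N,W], X, P 7 5 [W,S,W,W,N,N,E,N,E,E,S]], P 6 5 [S,W,W]], P 6 5
     [S,W,N,N,N,N,N], P 6 4 [W,N,N,E,E,N,N,N,W], X]]], P 7 7 [E,N,W,W,W,W,S]], X, P 5 8 [E,N,E], P
     4 6 [N,N,E,E,E,N,W]], P 4 8 [S,E,S], Q 0 1 11 1, X, X]], P 7 6 [W,W,N,N,N], X, P 5 8 [N,E,S],
     P 6 9 [W,S,S]], X, B 6 4 [P 5 6 [S,E,S], X, P 5 6 [E,S,S], P 6 9 [S,S,E,S,S,W,S], B 5 9 [B 6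
     10 [Q 0 1 12 3, B 7 9 [X, B 5 4 [X, B 4 4 [P 5 6 [S,S,W], X, P 6 7 [W,S,E,S,S,W,W], B 4 5 [X,
     P 4 6 [S,S,E], P 7 5 [W,S,W,W,N,N,E,N,E,N,W], X, P 7 5 [W,S,W,W,N,N,E,N,E,N,N]], P 6 5
     [S,W,W]], P 6 5 [S,W,N,N,N,N,N], P 6 10 [S,E,S,W,S,W,S,S,S], X], P 7 8 [N,W,W,S,S], P 6 5
     [E,N,N,W,N,N,E], X], P 6 5 [E,N,W,N,N,N,N], P 6 5 [E,N,N,W,N,N,N], X], P 7 6 [W,W,N,N,N], X,
     P 6 5 [E,N,N,W,N,N,W], X]]], X, P 7 5 [N,N,E]], X, X], X]], P 5 6 [N,E,N]], X, X, X], B 6 7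
     [P 5 7 [E,E,N], P 7 7 [W,W,S], X, B 7 6 [B 7 5 [X, X, P 5 6 [E,S,E], B 8 6 [X, B 5 4 [X, B 6
     4 [Q 0 3 12 11, X, P 5 4 [E,N,N], P 5 4 [E,N,E], B 4 5 [X, B 4 4 [P 4 5 [S,E,N], X, P 5 7
     [S,E,S,S,W,W,N], P 5 6 [W,S,S], P 4 5 [S,E,E]], P 8 6 [W,W,W,S,W], X, B 4 7 [P 6 7
     [W,W,S,S,E], B 3 7 [P 6 5 [S,W,N,N,N,W,W], X, P 5 4 [E,N,N,W,N,W,W], P 5 6 [W,N,W], P 5 6
     [N,W,W]], P 4 5 [N,N,E,E,S], X, X]]], P 8 6 [W,W,W,S,S], P 8 6 [W,S,W,W,S], B 6 4 [Q 0 3 12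
     11, X, P 5 6 [E,S,S], B 7 4 [P 6 4 [E,N,N], Q 0 3 13 11, P 8 6 [W,N,W,S,W,S,S,E,E], X, P 7 5
     [S,W,W]], X]], B 8 7 [P 6 6 [E,E,N], B 8 8 [X, X, P 5 7 [S,E,E,N,E,N,W], P 6 6
     [S,E,N,E,N,N,W], P 7 6 [N,N,E]], X, P 5 7 [E,E,E], X], Q 0 2 1 12, P 7 8 [S,S,E]], P 7 8
     [S,S,S]], B 7 5 [P 5 6 [S,E,E], X, P 5 6 [E,S,E], B 6 4 [P 5 6 [S,E,S], X, P 5 6 [E,S,S], P 7
     6 [S,W,S], B 8 6 [B 8 7 [X, P 4 6 [E,S,E,E,N,E,N], B 4 5 [X, P 8 6 [W,S,W,W,N,W,S], B 8 5 [X,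
     P 7 6 [E,S,W,W,W,N,W], P 7 6 [E,S,W,W,W,W,N], X, B 6 8 [X, P 4 5 [N,E,E,N,N], P 8 5
     [N,N,W,N,W], X, B 5 8 [P 5 7 [N,E,E], P 6 8 [W,S,S], B 4 7 [B 4 8 [X, P 5 8
     [W,S,E,E,S,E,E,S,W], X, B 8 8 [X, P 8 5 [N,W,N,N,E], X, P 7 7 [E,N,W,W,W,W,S], P 7 7
     [E,N,W,W,W,S,W]], P 8 7 [W,N,W,W,S,W,N]], P 8 6 [W,S,W,W,N,W,N], Q 0 1 11 1, X, X], Q 0 0
     (-1) 1, X]]], X, B 4 7 [P 6 7 [W,W,S,S,E], P 8 6 [W,S,W,W,N,W,N], P 4 5 [N,N,E,E,S], X, X]],
     P 5 7 [E,E,E], X], X, P 5 6 [E,E,E], Q 0 2 1 12, B 8 7 [P 8 6 [N,W,N], P 7 7 [E,S,W], B 8 5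
     [B 9 6 [B 9 7 [X, B 9 5 [X, P 8 5 [E,N,N], B 8 4 [X, Q 0 1 13 (-1), P 9 6 [S,W,S], B 7 4 [P 7
     5 [S,E,N], P 8 4 [W,N,W], B 8 8 [X, Q 0 0 2 1, X, P 6 5 [S,E,N,N,N,E,N], B 9 8 [P 7 7
     [N,E,E], X, P 7 7 [E,N,E], B 8 9 [P 7 7 [N,E,N], B 7 9 [X, X, B 6 8 [X, P 7 4 [N,W,N,N,N], Q
     0 1 13 2, X, B 5 8 [P 5 7 [N,E,E], P 6 8 [W,S,S], P 8 5 [N,N,W,N,W,W,S], Q 0 0 (-1) 1, X]], P
     8 8 [N,W,S,S,S,S,E], P 8 5 [N,W,N,N,E,N,W]], P 7 7 [E,N,N], B 7 9 [X, P 8 9 [W,S,E,E,S,S,W],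
     B 6 8 [X, P 7 4 [N,W,N,N,N], Q 0 1 13 2, X, B 5 8 [P 5 7 [N,E,E], P 6 8 [W,S,S], P 8 5
     [N,N,W,N,W,W,S], Q 0 0 (-1) 1, X]], X, P 9 8 [W,N,W]], X], X]], X, X], P 9 6 [W,S,S]], P 9 6
     [S,W,W], P 8 5 [E,N,W]], X, B 7 4 [P 9 7 [S,W,W,S,S,W,N], B 8 4 [X, X, B 9 5 [X, B 7 3 [B 6 3
     [X, P 7 4 [S,W,N,N,W,N,N], P 9 5 [W,S,W,S,W], P 9 5 [W,W,S,S,W], X], X, B 6 3 [P 6 6
     [E,E,S,S,W,W,S], P 8 4 [W,S,W], X, P 7 4 [S,W,N,N,N,N,W], X], P 6 5 [E,S,S], P 6 5 [S,E,S]],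
     P 9 6 [S,W,S], P 9 6 [S,W,W], P 8 5 [E,N,W]], P 6 5 [E,S,E], P 6 5 [S,E,E]], P 9 7
     [W,W,S,S,S,W,N], X, X], P 8 5 [N,E,N]], P 7 7 [S,E,E], P 7 7 [E,S,E], B 9 5 [X, P 9 6
     [S,W,W,W,W], P 5 6 [N,E,S,E,E,E,S], X, P 5 6 [N,E,E,S,E,E,S]], X], P 7 7 [S,E,S], P 7 7
     [E,S,S], X, X], P 5 7 [E,E,E], X]]], P 6 5 [E,N,N]], X, P 5 7 [E,E,S], X], X]]]]], H]], H]]"

lemma forbidden_rook_b: "forbidden False 5 rook_b"
proof (rule forbidden_by_cert[OF rook_separated_1])
  show "list_all (forbidden False 5) [rook_a]"
    by (simp add: forbidden_rook_a)
  show "refutes False 5 1 [rook_a] rook_b rook_cert_b [] 0"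
    by code_simp
qed

definition rook_cert_c :: cert where
  "rook_cert_c =
    B 6 5 [B 6 7 [B 7 6 [B 6 6 [X, B 5 5 [X, P 6 7 [S,S,W], B 7 5 [X, P 6 7 [S,S,E], P 7 6
     [S,W,W], B 7 7 [X, P 6 5 [N,N,E], B 8 6 [X, P 6 5 [N,E,E], P 6 7 [E,S,E], P 6 5 [E,N,E], B 5
     7 [X, P 6 5 [N,N,W], P 7 6 [N,W,W], B 5 6 [P 7 5 [W,W,N,N,E,E,S], X, X, X, B 6 4 [X, P 6 7
     [S,S,S], B 7 4 [P 5 5 [E,S,E], B 5 4 [P 5 5 [S,E,N], P 5 5 [S,E,E], X, B 6 8 [X, P 6 5
     [N,N,N], P 7 6 [N,W,N], B 7 8 [P 5 7 [E,N,E], P 6 5 [S,E,N,N,N,N,W], X, X, P 7 5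
     [W,W,N,N,E,E,N]], B 5 8 [P 5 5 [E,E,N,N,W,W,N], B 4 7 [P 5 5 [E,E,N,N,W,W,W], Q 0 1 11 1, B 4
     6 [P 5 8 [E,S,S,W,W], B 4 5 [P 6 4 [N,W,W], X, X, P 6 4 [W,N,W], Q 1 5 (-1) 11], X, Q 1 2
     (-1) 12, X], X, Q 0 3 11 13], P 6 8 [W,S,S,S,S], X, X]], Q 1 4 0 (-1)], X, X, P 7 7
     [W,W,S,S,E,E,S]], P 7 6 [S,W,S], B 5 4 [P 5 7 [E,E,S,S,W,W,S], B 4 5 [P 5 7 [E,E,S,S,W,W,W],
     Q 0 3 11 11, X, B 4 6 [P 5 4 [E,N,N,W,W], B 4 7 [P 7 6 [S,W,N,N,W,W,S], X, P 6 4 [W,N,N,W,N],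
     X, P 6 6 [W,W,N]], B 6 8 [X, P 6 5 [N,N,N], P 7 6 [N,W,N], Q 1 0 (-1) 0, B 4 7 [P 5 5
     [E,E,N,N,W,W,W], B 5 8 [P 5 5 [E,E,N,N,W,W,N], Q 0 1 11 1, P 6 8 [W,S,S,W,S], X, X], X, X, Q
     0 3 11 13]], X, X], Q 0 1 11 (-1)], X, B 6 8 [X, P 6 5 [N,N,N], P 7 6 [N,W,N], B 5 8 [P 5 7
     [N,E,S], B 7 8 [P 5 7 [E,N,E], P 5 7 [N,E,E], X, X, P 7 5 [W,W,N,N,E,E,N]], P 6 4
     [W,N,N,N,N], X, Q 1 5 0 13], B 4 7 [P 5 5 [E,E,N,N,W,W,W], B 5 8 [P 5 5 [E,E,N,N,W,W,N], Q 0
     1 11 1, P 6 4 [W,N,N,N,N], X, X], P 6 4 [W,N,N,N,W], X, Q 0 3 11 13]], X]]], B 5 6 [P 8 6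
     [W,N,W,W,S,S,E], X, X, B 6 8 [X, P 6 5 [N,N,N], P 7 6 [N,W,N], B 7 8 [P 5 5 [E,E,N,N,N,W,S],
     B 8 7 [B 8 8 [X, X, P 6 7 [E,E,N], B 5 8 [P 5 5 [E,E,N,N,W,N,W], P 8 8 [W,W,W], B 6 9 [P 5 5
     [E,E,N,N,W,N,N], P 8 8 [W,W,N], Q 0 1 12 2, X, Q 1 1 13 1], X, X], P 7 6 [E,N,N]], Q 0 0 1 1,
     X, P 7 6 [E,N,W,W,W,S,S], X], X, X, B 5 8 [P 5 5 [E,E,N,N,W,N,W], P 7 8 [W,W,S,S,E], P 7 8
     [W,W,S,S,S], X, X]], B 7 8 [P 5 7 [E,N,E], B 5 8 [P 5 7 [N,E,S], P 5 7 [N,E,E], B 4 7 [P 6 8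
     [S,W,W], B 8 7 [B 8 8 [X, X, P 6 7 [E,E,N], B 4 6 [P 7 5 [W,N,W,W,N], X, B 4 5 [P 4 6
     [S,E,E], P 5 5 [W,N,N], X, P 4 6 [S,E,N], Q 1 0 (-1) 0], X, B 4 5 [P 8 8 [S,W,S,S,W,W,W], P 5
     7 [W,S,S], X, P 5 7 [S,W,S], X]], P 7 6 [E,N,N]], Q 0 0 1 1, X, P 7 6 [E,N,W,W,W,S,S], X], P
     6 8 [W,S,W], Q 1 6 12 0, X], Q 1 1 12 0, X], X, P 6 5 [W,N,N,E,E,N,W], X]], X]]], P 6 7
     [E,S,S], B 8 6 [X, P 6 5 [N,E,E], B 5 7 [X, P 6 5 [N,N,W], B 5 4 [B 6 4 [X, P 5 4 [E,N,N], P
     5 4 [E,N,W], P 5 4 [E,N,E], B 4 4 [X, P 7 6 [N,W,S,S,S,W,W], P 6 5 [W,S,W], P 6 7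
     [E,S,S,W,S,W,W], P 6 5 [S,W,W]]], B 5 6 [P 5 7 [S,S,E], X, X, B 4 5 [B 6 4 [X, X, P 4 5
     [E,E,S], Q 0 2 0 11, B 4 6 [X, B 8 7 [P 4 6 [S,E,E,N,E,E,N], P 4 6 [S,E,S,E,N,N,E,E,N,W,W],
     X, P 4 6 [S,E,N,E,E,E,N], X], P 6 5 [W,W,N], X, B 4 7 [P 7 7 [W,W,W,S,S,E,E], P 7 7
     [W,W,W,S,S,E,S], X, Q 1 6 12 0, X]]], Q 0 3 11 11, X, P 5 7 [S,S,W], Q 1 7 12 12], B 5 8 [B 6
     8 [X, P 5 8 [E,S,S], P 5 8 [E,S,W], B 4 8 [X, P 7 6 [S,W,N,N,N,W,W], P 6 7 [W,N,W], P 6 7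
     [N,W,W], P 6 5 [E,N,N,W,N,W,W]], Q 0 0 0 1], B 4 7 [B 6 8 [X, X, P 4 7 [E,E,N], B 4 6 [X, B 8
     5 [P 4 6 [N,E,E,S,E,E,S], P 4 6 [N,E,N,E,S,S,E,E,S,W,W], X, X, P 4 6 [N,E,S,E,E,E,S]], P 6 7
     [W,W,S], B 4 5 [P 7 5 [W,W,W,N,N,E,E], Q 0 3 11 11, X, X, Q 1 7 12 12], X], Q 0 0 0 1], Q 0 1
     11 1, X, Q 1 6 12 0, P 5 5 [N,N,W]], X, Q 1 1 12 0, P 5 5 [N,N,N]]], X, B 5 6 [P 5 7 [S,S,E],
     X, X, P 5 7 [S,S,S], B 5 8 [B 6 8 [X, P 5 8 [E,S,S], P 5 8 [E,S,W], B 4 8 [X, P 7 6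
     [S,W,N,N,N,W,W], P 6 7 [W,N,W], P 6 7 [N,W,W], P 6 5 [E,N,N,W,N,W,W]], Q 0 0 0 1], B 4 7 [B 6
     8 [X, X, P 4 7 [E,E,N], B 4 6 [X, B 8 5 [P 4 6 [N,E,E,S,E,E,S], P 4 6
     [N,E,N,E,S,S,E,E,S,W,W], X, X, P 4 6 [N,E,S,E,E,E,S]], P 6 7 [W,W,S], B 4 5 [P 7 5
     [W,W,W,N,N,E,E], P 7 5 [W,W,W,N,N,E,N], X, X, Q 1 7 12 12], X], Q 0 0 0 1], Q 0 1 11 1, X, Q
     1 6 12 0, P 5 5 [N,N,W]], X, Q 1 1 12 0, P 5 5 [N,N,N]]], Q 1 3 12 12], B 5 6 [P 6 7
     [W,S,S,E,E,N,E], X, X, X, B 6 4 [X, P 6 7 [S,S,S], B 7 4 [P 5 5 [E,S,E], B 5 4 [P 5 5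
     [S,E,N], P 5 5 [S,E,E], X, B 4 5 [P 6 4 [N,W,W], B 8 5 [B 8 4 [X, X, P 7 6 [E,S,S], P 6 5
     [E,E,S], B 4 6 [P 7 7 [W,S,W,W,S], X, B 4 7 [P 8 4 [N,W,N,N,W,W,W], P 5 5 [W,N,N], X, X, P 5
     5 [N,W,N]], B 4 7 [P 4 6 [N,E,E], P 5 7 [W,S,S], Q 1 2 (-1) 12, X, P 4 6 [N,E,S]], X]], Q 0 2
     1 11, X, X, P 7 6 [E,S,W,W,W,N,N]], X, P 6 4 [W,N,W], Q 1 7 12 12], Q 1 0 0 (-1)], X, X, P 6
     7 [W,S,S,E,E,S,W]], P 7 6 [S,W,S], B 7 4 [P 5 7 [E,E,S,S,S,W,N], B 8 5 [B 8 4 [X, X, P 7 6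
     [E,S,S], P 6 5 [E,E,S], B 5 4 [P 5 7 [E,E,S,S,W,S,W], P 8 4 [W,W,W], X, B 6 3 [P 5 7
     [E,E,S,S,W,S,S], P 8 4 [W,W,S], Q 1 3 13 11, Q 0 3 12 10, X], X]], Q 0 2 1 11, X, X, P 7 6
     [E,S,W,W,W,N,N]], B 5 4 [P 5 7 [E,E,S,S,W,S,W], P 7 4 [W,W,N,N,E], X, P 7 4 [W,W,N,N,N], X],
     X, X]]], P 7 6 [N,W,W]], P 6 5 [E,N,E], P 6 7 [E,S,E]]]]]], H], H]]"

lemma forbidden_rook_c: "forbidden False 5 rook_c"
proof (rule forbidden_by_cert[OF rook_separated_1])
  show "list_all (forbidden False 5) [rook_a, rook_b]"
    by (simp add: forbidden_rook_a forbidden_rook_b)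
  show "refutes False 5 1 [rook_a, rook_b] rook_c rook_cert_c [] 0"
    by code_simp
qed

text \<open>The indices 0, 1, 2 of the \<open>Q\<close> leaves refer to \<open>rook_a\<close>,
  \<open>rook_b\<close>, \<open>rook_c\<close>. The common neighbours (6, 7) and (7, 6) of the
  assumed pair again need different colours.\<close>

definition rook_cert_2 :: cert where
  "rook_cert_2 =
    B 6 6 [B 7 7 [B 5 6 [X, B 6 7 [X, P 7 7 [W,S,W], B 7 6 [X, P 7 7 [S,W,W], P 6 6 [E,N,W], B 6 8
     [Q 2 0 0 1, B 7 8 [X, X, P 6 6 [N,E,N], P 6 6 [E,N,N], B 5 8 [Q 0 2 0 13, X, B 4 7 [B 4 8 [X,
     P 6 7 [N,W,W], X, Q 1 6 12 1, B 5 7 [X, X, X, B 7 5 [Q 2 1 13 0, P 4 7 [E,S,E,E,S], P 4 7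
     [E,E,S,E,S], X, B 6 5 [X, B 5 5 [Q 0 2 (-1) 12, X, B 4 6 [X, X, Q 0 0 (-1) 1, B 8 6 [Q 2 4 1
     0, P 4 7 [S,E,E,E,E], P 4 7 [E,E,S,E,E], X, B 5 4 [P 6 8 [S,S,W,S,S], Q 2 0 (-1) (-1), X, P 6
     8 [W,S,S,S,S], B 6 4 [Q 1 2 (-1) 12, X, Q 1 4 0 (-1), B 7 4 [P 5 4 [E,E,N,N,W], B 8 5 [Q 0 1
     13 0, Q 1 1 13 0, B 8 7 [X, B 8 4 [P 6 7 [E,E,S,S,S,W,N], X, X, P 6 5 [S,E,E], Q 2 1 14
     (-1)], Q 1 4 0 0, Q 1 0 1 (-1), X], Q 0 0 1 (-1), X], P 7 6 [S,S,W,W,N], X, X], X]]], P 5 5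
     [N,W,N,E,N,E,E,S,S]], P 6 5 [W,N,N], Q 1 0 0 0], P 7 7 [W,S,S], Q 0 2 0 12, X]], P 6 7
     [W,N,W]]], Q 0 3 11 13, Q 2 4 (-1) 1, B 5 7 [Q 2 5 0 13, X, X, X, B 4 8 [B 5 9 [B 6 9 [X, X,
     Q 2 1 12 2, B 7 5 [Q 2 1 13 0, P 5 8 [N,E,S,S,S,E,S], B 8 6 [Q 2 4 1 0, P 5 8
     [N,E,S,S,S,E,E], Q 0 2 1 12, X, P 5 8 [W,S,E,E,S,E,E]], X, P 5 8 [W,S,E,E,S,E,S]], Q 0 0 0
     2], P 6 7 [N,W,N], X, Q 1 1 12 1, P 6 7 [W,N,N]], P 6 7 [N,W,W], X, X, P 6 7 [W,N,W]]], B 5 7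
     [Q 2 5 0 13, X, X, B 4 8 [B 4 6 [B 6 5 [X, P 4 6 [E,E,S], P 7 7 [W,S,S], Q 0 2 0 12, B 5 5 [Q
     2 5 (-1) 12, X, B 4 5 [X, Q 1 3 11 13, X, P 6 8 [W,S,S,S,W], P 4 8 [S,S,S]], P 5 8
     [W,S,E,E,S,S,W], X]], X, Q 0 0 (-1) 1, B 5 5 [B 6 5 [X, P 5 5 [E,N,W], P 5 5 [E,N,N], Q 0 1
     11 0, B 4 5 [X, Q 1 3 11 13, P 6 5 [W,W,N,N,N,E,S], X, P 5 7 [W,S,S]]], X, B 4 5 [P 6 8
     [S,S,W,S,W], Q 1 3 11 13, X, X, P 5 7 [W,S,S]], Q 2 1 11 0, B 6 5 [X, Q 1 0 0 0, P 7 7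
     [W,S,S], Q 0 1 11 0, X]], X], P 6 7 [N,W,W], X, Q 1 6 12 1, X], X]], B 5 7 [Q 2 5 0 13, X, X,
     X, B 6 5 [X, B 5 5 [P 5 6 [S,E,N], X, P 7 8 [W,S,W,S,S], P 7 8 [W,W,S,S,S], Q 1 0 0 0], P 7 7
     [W,S,S], P 7 7 [S,W,S], B 4 6 [B 5 5 [Q 2 5 (-1) 12, X, P 7 8 [W,S,W,S,S], P 7 8 [W,W,S,S,S],
     X], X, P 7 8 [W,S,W,S,W], P 7 8 [W,W,S,S,W], Q 0 1 11 0]]], B 5 7 [Q 2 5 0 13, X, X, B 5 9 [B
     6 9 [X, X, B 7 9 [P 5 8 [N,E,E,S,S,W,S], P 6 7 [N,N,E], X, P 5 8 [N,E,E,S,S,W,W], X], B 7 9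
     [P 5 8 [N,E,E,S,S,S,W], P 5 8 [E,E,N], P 5 6 [N,E,N,N,E], X, X], Q 2 4 0 2], P 7 8 [W,W,N], B
     6 9 [P 5 6 [E,N,N,N,W], X, X, P 5 6 [N,E,N,N,W], Q 2 4 0 2], Q 1 1 12 1, X], X]]], X, B 5 7
     [Q 2 5 0 13, X, X, Q 0 1 12 1, B 5 8 [Q 0 2 0 13, B 4 8 [B 4 7 [X, Q 2 1 11 1, B 4 6 [P 5 8
     [W,S,S,E,E,N,E], X, X, P 5 8 [W,S,S,E,E,N,N], P 6 7 [W,W,S]], B 4 6 [P 5 8 [W,S,S,E,E,E,N],
     X, B 7 5 [Q 2 1 13 0, B 6 5 [X, X, P 7 7 [W,S,S], Q 1 1 12 0, B 5 5 [B 8 6 [Q 2 4 1 0, B 4 5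
     [X, P 6 6 [W,S,W], X, B 8 7 [X, X, P 6 6 [N,E,E], Q 0 2 1 13, P 8 6 [N,W,S,S,W,W,W]], P 6 6
     [S,W,W]], P 5 8 [W,S,S,E,E,E,E], X, P 5 8 [W,S,E,S,E,E,E]], X, Q 0 3 11 12, P 7 5
     [W,W,N,N,W], X]], P 5 8 [W,S,S,E,E,E,S], X, P 5 8 [W,S,E,S,E,E,S]], X, P 5 8 [S,S,W]], X], X,
     B 5 9 [B 7 8 [X, B 6 9 [X, Q 2 4 0 2, B 7 9 [P 5 8 [N,E,E,S,S,W,S], X, X, P 6 7 [N,N,E], P 5
     6 [E,N,W,N,N,E,E]], X, B 4 7 [B 8 7 [X, B 7 9 [P 8 7 [W,N,N], X, B 8 8 [P 7 8 [E,S,W], X, Q 0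
     0 1 2, P 5 8 [E,E,E], B 4 6 [X, X, B 5 5 [Q 0 2 (-1) 12, X, Q 0 3 11 12, P 8 7
     [N,W,W,W,S,S,S], P 5 8 [S,S,S]], P 8 7 [N,W,W,W,S,S,W], P 5 8 [S,S,W]]], P 5 8 [E,E,N], X], P
     6 6 [N,E,E], Q 0 2 1 13, P 4 8 [S,E,E,E,E]], Q 2 1 11 1, X, P 6 9 [S,S,W,W,N], X]], P 6 6
     [N,E,N], X, B 4 7 [P 7 8 [S,W,W,W,N], Q 2 1 11 1, X, P 7 8 [W,S,W,W,N], X]], X, Q 0 1 11 2, Q
     1 1 12 1, P 5 6 [N,N,N]], Q 1 6 12 1, P 5 6 [N,N,W]], B 4 6 [B 6 5 [X, P 4 6 [E,E,S], P 7 7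
     [W,S,S], P 7 7 [S,W,S], B 4 7 [X, P 6 6 [W,W,N], Q 2 4 (-1) 1, B 4 8 [B 7 8 [X, P 4 8
     [S,S,E,E,E,N,N], Q 2 5 0 14, X, B 8 7 [X, P 4 8 [S,S,E,E,E,N,E], P 6 6 [N,E,E], Q 0 2 1 13, B
     8 8 [P 7 8 [E,S,W], Q 1 7 13 13, P 4 7 [E,N,E,E,E], P 8 7 [N,W,W], X]]], B 5 5 [Q 2 5 (-1)
     12, X, P 6 5 [W,N,N,N,W], P 6 5 [W,N,N,W,N], X], X, X, P 6 7 [W,N,W]], X]], X, Q 0 0 (-1) 1,
     B 4 7 [B 4 8 [X, P 7 6 [W,W,W,N,N], X, Q 1 6 12 1, P 6 7 [W,N,W]], B 4 8 [B 7 8 [X, P 6 7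
     [E,N,W,W,W,S,S], Q 2 5 0 14, X, B 6 9 [B 7 5 [Q 2 1 13 0, B 6 5 [X, X, P 7 7 [W,S,S], Q 1 6
     12 0, B 5 5 [B 4 5 [X, Q 2 0 (-2) 0, P 5 6 [S,W,N,N,N,E,E], X, P 6 6 [S,W,W]], X, P 7 5
     [W,W,N,N,N], P 4 7 [S,E,S], X]], P 6 9 [S,S,S,E,S], X, P 6 9 [S,E,S,S,S]], B 5 9 [P 4 6
     [E,E,N,N,N,W,S], X, X, Q 1 1 12 1, P 6 7 [W,N,N]], Q 2 1 12 2, X, Q 0 0 0 2]], X, X, Q 1 6 12
     1, P 5 6 [N,W,N]], Q 2 4 (-1) 1, X, X], B 6 5 [X, B 4 5 [B 4 7 [P 5 7 [W,S,S], P 4 6 [N,E,S],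
     Q 2 4 (-1) 1, B 7 5 [Q 2 1 13 0, X, B 5 5 [X, X, P 5 6 [S,E,E], B 8 6 [Q 2 4 1 0, P 4 5
     [E,N,E,E,E], Q 0 2 1 12, X, B 8 7 [X, P 4 7 [S,E,E,E,E,N,W], P 6 6 [N,E,E], Q 0 2 1 13, X]],
     Q 1 4 (-1) 0], X, B 4 8 [P 6 5 [E,N,W,W,W,N,N], B 3 7 [P 6 5 [E,N,W,W,W,N,W], Q 0 1 10 1, B 7
     8 [X, P 3 7 [E,N,E,E,E], Q 2 5 0 14, X, P 3 7 [E,E,N,E,E]], X, Q 2 5 (-2) 13], X, X, Q 2 0
     (-2) 1]], X], Q 2 4 (-1) (-1), B 5 5 [P 5 6 [S,E,N], X, X, B 7 8 [X, P 4 6 [S,E,N,N,N,E,E], Q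
     2 5 0 14, X, B 6 9 [B 7 5 [Q 2 1 13 0, X, P 6 9 [S,S,S,E,S], X, P 6 9 [S,E,S,S,S]], P 4 6
     [S,E,N,N,N,E,N], Q 2 1 12 2, X, Q 0 0 0 2]], Q 2 1 11 0], Q 1 3 11 13, X], P 7 7 [W,S,S], P 7
     7 [S,W,S], Q 0 1 11 0]], X, X]], B 7 8 [X, B 5 8 [Q 0 2 0 13, B 5 7 [Q 2 5 0 13, X, X, B 4 7
     [B 4 8 [X, X, P 7 6 [W,N,W,W,N], Q 1 6 12 1, P 7 8 [W,W,W]], Q 2 1 11 1, B 4 6 [B 4 8 [P 7 8
     [S,W,S,W,W,N,N], X, X, Q 1 6 12 1, P 7 8 [W,W,W]], X, X, P 6 7 [W,W,S], P 7 7
     [N,W,S,S,W,W,N]], X, B 7 9 [B 5 9 [B 6 9 [X, Q 2 4 0 2, P 5 6 [E,N,E,N,N,W,W], P 5 6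
     [E,E,N,N,N,W,W], X], X, B 6 9 [X, Q 2 4 0 2, X, P 4 7 [E,E,N,N,W], X], Q 1 1 12 1, Q 0 0 (-1)
     2], X, B 6 9 [B 6 5 [X, B 4 6 [P 6 5 [N,W,W], X, B 5 5 [P 5 6 [S,E,N], X, Q 0 3 11 12, P 5 8
     [S,S,S], B 8 8 [Q 0 2 1 14, X, Q 0 0 1 2, P 6 5 [W,N,N,N,E,E,E], P 5 8 [E,E,E]]], P 5 8
     [S,S,W], X], P 7 7 [W,S,S], Q 0 2 0 12, P 7 9 [W,S,S,S,S]], Q 2 4 0 2, X, P 7 9 [W,S,S,W,W],
     X], B 6 9 [B 5 9 [X, X, B 6 5 [X, B 4 6 [P 6 5 [N,W,W], X, B 5 5 [P 5 6 [S,E,N], X, Q 0 3 11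
     12, P 5 8 [S,S,S], P 6 5 [W,N,N,N,E,E,N]], P 5 8 [S,S,W], X], P 7 7 [W,S,S], Q 0 2 0 12, P 5
     9 [E,S,S,S,S]], Q 1 1 12 1, Q 0 0 (-1) 2], Q 2 4 0 2, P 6 6 [W,N,E,E,N,N,W], X, X], P 5 8
     [E,E,N]]], P 5 6 [N,N,E]], B 5 7 [Q 2 5 0 13, X, X, B 7 9 [B 6 9 [X, P 7 7 [N,N,W], Q 2 1 12
     2, B 8 7 [X, P 7 9 [S,S,E], P 6 6 [N,E,E], P 6 6 [E,N,E], B 5 9 [P 5 6 [E,E,N,N,N,W,W], B 8 8
     [Q 2 0 1 2, X, P 8 7 [N,W,W,W,N], P 8 7 [N,W,W,N,W], X], X, X, P 6 7 [N,W,N]]], X], X, Q 0 3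
     12 14, B 5 9 [B 6 9 [X, P 7 9 [W,W,S,S,S,E,N], Q 2 1 12 2, X, X], B 6 9 [P 7 6 [N,N,N,W,W],
     X, Q 2 1 12 2, X, X], X, Q 1 1 12 1, P 6 7 [N,W,N]], B 8 7 [X, B 8 9 [B 6 9 [P 6 8 [N,E,E], P
     6 8 [N,E,S], Q 2 1 12 2, B 8 8 [X, X, B 8 6 [Q 2 4 1 0, X, P 7 8 [E,S,S], X, B 5 9 [P 8 6
     [W,W,N,N,N,W,S], B 6 10 [P 8 7 [S,W,N,N,W,N,N], Q 0 1 12 3, P 5 6 [N,N,N,E,N], X, Q 2 0 0 3],
     X, X, Q 2 5 0 15]], B 9 8 [Q 0 0 2 2, Q 2 5 2 14, P 6 6 [W,N,E,E,N,E,E], X, B 5 9 [P 9 8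
     [W,N,W,W,W], P 9 8 [W,W,W,N,W], X, X, Q 2 5 0 15]], Q 1 3 13 14], X], Q 2 1 14 2, B 8 8 [P 7
     8 [E,S,W], X, X, P 7 9 [E,S,W,W,W,S,S], Q 2 4 1 2], Q 1 4 0 2, X], P 6 6 [N,E,E], P 6 6
     [E,N,E], Q 0 1 13 2]], P 5 8 [S,E,N]], B 5 7 [Q 2 5 0 13, X, X, X, B 8 7 [X, B 8 6 [Q 2 4 1
     0, X, B 8 8 [P 7 8 [E,S,W], X, P 7 8 [E,S,S], B 7 5 [Q 2 1 13 0, B 6 5 [X, X, P 7 7 [W,S,S],
     Q 1 3 13 13, B 5 5 [B 4 5 [X, P 6 6 [W,S,W], P 6 8 [E,S,W,W,S,S,W], B 4 6 [Q 2 5 (-1) 12, X,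
     P 7 7 [E,S,W,W,W,W,S], X, Q 0 1 11 0], P 6 6 [S,W,W]], X, P 7 5 [W,W,N,N,E], P 7 5
     [W,W,N,N,N], X]], Q 0 2 1 12, X, B 6 5 [X, P 5 8 [E,E,S,S,S,W,N], P 7 7 [W,S,S], Q 1 3 13 13,
     X]], P 8 7 [N,W,W]], X, P 7 7 [E,S,W,W,W,N,N]], P 6 6 [N,E,E], P 6 6 [E,N,E], B 6 9 [B 8 6 [Q
     2 4 1 0, P 6 9 [S,E,S,E,S], P 6 9 [S,S,E,E,S], X, X], B 5 9 [P 6 8 [N,W,S,S,S,E,E], X, B 7 9
     [P 6 9 [E,S,S], X, P 7 8 [N,W,W], B 8 8 [B 8 9 [X, Q 2 5 1 15, P 5 7 [S,E,N,N,E,E,N], X, P 7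
     7 [E,N,N]], X, B 8 6 [Q 2 4 1 0, P 6 7 [N,E,E,S,S], B 8 9 [P 5 7 [E,E,E,N,N], Q 2 5 1 15, X,
     X, P 8 6 [N,N,N]], X, X], P 6 9 [E,S,E], X], Q 0 1 13 2], X, Q 2 0 (-1) 2], P 5 7 [E,N,N], P
     5 7 [N,E,N], X]]], X], P 6 6 [N,E,N], P 6 6 [E,N,N], X]]]]], H]]"

lemma rook_forbidden_2: "forbidden False 5 [((6, 6), (7, 7))]"
proof (rule forbidden_by_cert[OF rook_separated_1])
  show "list_all (forbidden False 5) [rook_a, rook_b, rook_c]"
    by (simp add: forbidden_rook_a forbidden_rook_b forbidden_rook_c)
  show "refutes False 5 1 [rook_a, rook_b, rook_c] [((6, 6), (7, 7))] rook_cert_2 [] 0"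
    by code_simp
qed

lemma rook_separated_2: "separated False 5 2"
  by (rule separated_extend[OF rook_separated_1 rook_forbidden_2]) (simp_all add: doubleton_eq_iff)

definition rook_cert_4 :: cert where
  "rook_cert_4 =
    B 5 5 [B 7 5 [B 6 6 [X, B 5 6 [X, X, B 6 5 [X, X, X, B 4 6 [X, B 7 6 [X, X, P 4 6 [E,E,E], X,
     B 4 5 [X, X, X, P 7 5 [W,W,W], B 3 6 [B 8 5 [X, B 7 4 [X, X, P 4 6 [S,E,N,E,E,S,S], X, B 5 4
     [X, B 6 4 [X, X, P 3 6 [E,E,S,S,E], X, X], B 6 4 [X, P 7 5 [S,W,W,N,W,N,E], X, X, X], X, X]],
     P 4 6 [S,E,N,E,E,S,E], P 5 5 [E,E,E], X], X, P 6 6 [W,W,W], P 7 5 [N,W,S,W,W,N,W], X]]], X, B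
     5 4 [X, B 6 4 [X, X, P 4 6 [E,E,S,S,W], X, B 4 5 [X, X, X, X, B 4 4 [X, X, B 6 7 [P 4 4
     [E,N,N,E,N], X, X, B 5 7 [B 7 6 [X, X, B 7 7 [P 5 6 [N,E,E,S,S,W,W], X, X, X, P 5 6
     [N,E,E,S,S,W,S]], X, B 7 7 [P 4 5 [E,E,E,N,N,W,W], X, B 6 8 [X, P 6 5 [N,N,N], X, X, B 7 8 [P
     4 6 [E,N,E,E,N], P 4 6 [E,E,N,E,N], X, X, X]], X, X]], X, X, X, P 6 7 [W,S,W,S,S]], B 7 6 [X,
     X, B 5 7 [B 7 7 [P 7 5 [N,N,W,W,S,S,W], X, X, P 5 4 [E,N,N,N,E], X], X, X, X, X], X, X]], P 6
     6 [S,S,W,W,N], X]]], B 5 7 [P 5 4 [N,N,N], X, X, X, B 4 5 [X, B 6 7 [P 4 6 [S,E,E,N,N], X, X,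
     B 6 4 [X, P 6 7 [S,S,S], X, X, B 6 8 [P 5 4 [E,N,W,N,N,E,N], P 6 5 [N,N,N], P 4 5
     [N,E,E,N,N], X, X]], X], X, X, B 4 7 [P 5 7 [W,S,S,E,E], B 6 7 [B 7 6 [X, X, B 6 4 [X, B 7 4
     [X, X, P 5 5 [S,E,E,N,N,W,W], X, P 6 6 [E,S,S,W,W,N,W]], X, X, B 7 4 [X, B 7 7 [X, X, X, P 7
     4 [N,W,N,N,E], B 8 7 [P 5 7 [E,E,E], P 5 5 [S,E,E,N,N,N,E], X, P 5 5 [S,E,N,E,N,N,E], X]], P
     7 6 [S,S,W,W,N,N,N], X, X]], X, P 7 5 [N,W,N,W,W]], X, X, P 6 6 [N,W,W,S,S], X], X, X, X]]],
     X, B 4 5 [X, B 6 4 [X, B 6 7 [P 4 6 [S,E,E,N,N], X, X, P 6 4 [N,N,N], B 5 7 [B 6 3 [P 4 6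
     [S,E,E,S,S], X, P 5 7 [E,S,W,S,S,E,S], P 6 6 [S,S,S], X], X, X, X, X]], P 4 5 [N,E,E,S,S], X,
     X], X, X, X]], B 4 5 [X, B 6 7 [B 5 7 [X, X, X, P 4 5 [E,E,N,N,W], X], X, X, B 5 7 [B 5 4 [X,
     X, P 5 7 [S,S,S], X, B 7 6 [X, X, B 7 7 [P 5 6 [N,E,E,S,S,W,W], X, X, X, P 6 5
     [E,N,N,W,W,S,W]], X, B 7 7 [P 5 4 [N,E,E,N,N,W,W], X, P 4 5 [N,E,E,E,N], X, X]]], X, X, X,
     X], B 7 6 [X, X, B 5 7 [B 5 4 [X, X, P 5 7 [S,S,S], X, B 7 7 [P 7 5 [N,N,W,W,S,S,S], X, X, B
     6 8 [X, B 5 8 [X, X, P 5 5 [N,N,N], P 6 8 [W,S,E,S,S,W,S], X], P 4 5 [N,E,E,N,N], X, X], X]],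
     X, X, B 4 7 [B 6 4 [X, B 5 4 [X, X, B 7 4 [X, X, P 5 5 [S,E,E,N,N,W,W], X, P 5 5
     [S,E,E,N,N,W,N]], X, P 6 4 [W,N,W,N,N]], P 4 7 [E,S,S,E,S], X, B 5 4 [X, X, B 7 4 [X, P 5 7
     [E,S,S,S,E], P 7 6 [S,S,W,W,N,N,W], X, X], X, X]], P 6 5 [N,N,W,W,S], X, X, X], X], X, X]],
     X, P 7 5 [W,W,W], X]]]]], H]]"

lemma rook_forbidden_4: "forbidden False 5 [((5, 5), (7, 5))]"
proof (rule forbidden_by_cert[OF rook_separated_2])
  show "list_all (forbidden False 5) []"
    by (simp)
  show "refutes False 5 2 [] [((5, 5), (7, 5))] rook_cert_4 [] 0"
    by code_simp
qed

lemma rook_separated_4: "separated False 5 4"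
  by (rule separated_extend[OF rook_separated_2 rook_forbidden_4]) (simp_all add: doubleton_eq_iff)

text \<open>The vertex (6, 6) and its four neighbours are pairwise within squared distance 4, so
  they use all five colours. This leaves (5, 7) only the colours of (6, 5) and (7, 6), each a
  knight's move away; both choices propagate to repetitive paths on six vertices.\<close>

definition rook_cert :: cert where
  "rook_cert =
    B 6 6 [B 5 6 [X, B 6 5 [X, X, B 6 7 [X, X, X, B 7 6 [X, X, X, X, B 5 7 [X, X, B 7 7 [X, B 5 5
     [X, X, X, P 6 5 [W,N,N,E,E], B 4 6 [X, X, X, B 4 5 [P 7 7 [W,S,W,W,S], X, X, X, X], X]], X,
     X, X], X, B 5 5 [X, X, X, B 4 6 [X, X, B 7 5 [X, B 4 7 [P 7 5 [W,N,W,W,N], X, X, X, X], X, X,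
     X], X, X], X]]]]]]]"

lemma rook_forbidden: "forbidden False 5 []"
proof (rule forbidden_by_cert[OF rook_separated_4])
  show "list_all (forbidden False 5) []"
    by (simp)
  show "refutes False 5 4 [] [] rook_cert [] 0"
    by code_simp
qed


theorem theorem1p7:
  shows "thue_number (cart_prod path_graph path_graph) \<ge> 6
       \<and> thue_number (strong_prod path_graph path_graph) \<ge> 9"
proof
  \<comment> \<open>The strict bound by 5 becomes a bound by its successor 6 in the extended
    naturals.\<close>
  have "eSuc (enat 5) \<le> thue_number (cart_prod path_graph path_graph)"
    using thue_number_gt[OF rook_forbidden] by (simp add: grid_def ileI1)
  then show "thue_number (cart_prod path_graph path_graph) \<ge> 6"
    by (simp add: eSuc_enat numeral_eq_enat)
  have "eSuc (enat 8) \<le> thue_number (strong_prod path_graph path_graph)"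
    using thue_number_gt[OF king_forbidden] by (simp add: grid_def ileI1)
  then show "thue_number (strong_prod path_graph path_graph) \<ge> 9"
    by (simp add: eSuc_enat numeral_eq_enat)
qed

end
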